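(* Let $d=1$, $N\ge1$, $T>0$, let $L\subset\mathbb{R}$ be a lattice, and let $$\left\{\frac{d}{dt}X=A_\alpha(t)X\right\}_{\alpha\in\mathbb{S}^1\cong\mathbb{R}/L}$$ be a periodically parameterized periodic linear ODE with $N\times N$ complex coefficient matrix $A_\alpha(t)=A(\alpha,t)$ and with $T$ the period of $A(\alpha,\cdot)$. Assume that the monodromy matrix is locally $C^1$-diagonalizable and that the Type II.a homotopy class of every characteristic multiplier $\lambda_n$, $1\le n\le N$, is trivial, and let $P:\mathbb{R}/\tilde L\times\mathbb{R}/T\mathbb{Z}\to\mathrm{GL}_N(\mathbb{C})$ be the corresponding Lyapunov transform. Then the Type II.b homotopy class, i.e. the homotopy class of $P$ in $[\mathbb{R}/\tilde L\times\mathbb{R}/T\mathbb{Z},\mathrm{GL}_N(\mathbb{C})]$, is uniquely determined by the homotopy class of $\Delta\circ P\circ\iota$ in $\pi_1(\mathbb{S}^1)$. (That is: if $P_1,P_2$ are two Lyapunov transforms arising in this way from such parameterized ODEs, with the same $N$, $T$ and $\tilde L$, and $\Delta\circ P_1\circ\iota$ and $\Delta\circ P_2\circ\iota$ are homotopic, then $P_1$ and $P_2$ are homotopic.)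
   Context: Setting: $A:\mathbb{R}\times\mathbb{R}\to\mathrm{Mat}_{N\times N}(\mathbb{C})$, $(\gamma,t)\mapsto A(\gamma,t)$, is continuously differentiable, $L$-periodic in $\gamma$ and $T$-periodic in $t$; for $\alpha=\gamma\bmod L$ one writes $A(\alpha,t)=A(\gamma,t)$. $X_\gamma(t)$ is the fundamental solution: $\frac{d}{dt}X_\gamma=A(\gamma,t)X_\gamma$, $X_\gamma(0)=\mathrm{Id}_N$. The monodromy matrix is $X_\gamma(T)$; its eigenvalues are the characteristic multipliers. Local $C^1$-diagonalizability of $\gamma\mapsto X_\gamma(T)$: each $\gamma$ has a neighborhood $W$ with continuously differentiable functions $\lambda_1,\ldots,\lambda_N:W\to\mathbb{C}$ and $\eta_1,\ldots,\eta_N:W\to\mathbb{CP}^{N-1}$ such that for all $\gamma'\in W$ the tuple $(\lambda_n(\gamma'))_n$ gives the eigenvalues of $X_{\gamma'}(T)$, $(\eta_n(\gamma'))_n$ are the respective eigenspaces, and these span $\mathbb{C}^N$. Data: $(\lambda_1(\gamma),\ldots,\lambda_N(\gamma))$, $\gamma\in\mathbb{R}$, is a continuously differentiable parameterization of the characteristic multipliers with corresponding continuously differentiably parameterized eigenspaces $\eta_n:\mathbb{R}\to\mathbb{CP}^{N-1}$ (spanning $\mathbb{C}^N$ at each $\gamma$). $L_n\subset L$ is the maximal sublattice such that $\lambda_n$ is $L_n$-periodic; $\lambda_n$ and $\eta_n$ are regarded as functions on $\mathbb{R}/L_n$. The Type II.a homotopy class of $\lambda_n$ is its class in $[\mathbb{R}/L_n,\mathbb{C}^*]$;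 trivial means null-homotopic. $(\mu_1(\gamma),\ldots,\mu_N(\gamma))$ is a continuously differentiable choice of characteristic exponents, $\exp(T\mu_n)=\lambda_n$. The Floquet exponent matrix is $F(\gamma)=V(\gamma)\,\mathrm{diag}(\mu_1(\gamma),\ldots,\mu_N(\gamma))\,V(\gamma)^{-1}$, where the $n$th column of $V(\gamma)$ is a nonzero vector in $\eta_n(\gamma)$, and the corresponding Lyapunov transform is $P(\gamma,t)=X_\gamma(t)\exp(-tF(\gamma))$. With $\tilde L=\bigcap_{n=1}^N L_n$ (a lattice in $\mathbb{R}$), $P$ is $\tilde L$-periodic in $\gamma$ and $T$-periodic in $t$, hence is a map on $\mathbb{R}/\tilde L\times\mathbb{R}/T\mathbb{Z}$. The Type II.b homotopy class is the homotopy class of $P$ in $[\mathbb{R}/\tilde L\times\mathbb{R}/T\mathbb{Z},\mathrm{GL}_N(\mathbb{C})]$, where $[Y,Z]$ denotes homotopy classes of continuous maps. Maps: $\Delta:\mathrm{GL}_N(\mathbb{C})\to\mathbb{S}^1$, $\Delta(M)=\det(M)/|\det(M)|$ (with $\mathbb{S}^1$ the unit circle in $\mathbb{C}$), and $\iota:\mathbb{R}/T\mathbb{Z}\cong\mathbb{S}^1\to\mathbb{R}/\tilde L\times\mathbb{R}/T\mathbb{Z}$, $\iota(\bar t)=(0,\bar t)$. *)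

theory Defs
  imports "HOL-Analysis.Analysis"
begin

definition multiples :: "real \<Rightarrow> real set" where
  "multiples T = range (\<lambda>k::int. of_int k * T)"

definition is_lattice :: "real set \<Rightarrow> bool" where
  "is_lattice L \<longleftrightarrow> (\<exists>l. l \<noteq> 0 \<and> L = multiples l)"

definition periodic_mod :: "real set \<Rightarrow> (real \<Rightarrow> 'a) \<Rightarrow> bool" where
  "periodic_mod L f \<longleftrightarrow> (\<forall>l\<in>L. \<forall>x. f (x + l) = f x)"

definition maximal_period_lattice :: "real set \<Rightarrow> (real \<Rightarrow> 'a) \<Rightarrow> real set \<Rightarrow> bool" where
  "maximal_period_lattice L f M \<longleftrightarrow>
     is_lattice M \<and> M \<subseteq> L \<and> periodic_mod M f \<and>
     (\<forall>M'. is_lattice M' \<and> M' \<subseteq> L \<and> periodic_mod M' f \<and> M \<subseteq> M' \<longrightarrow> M' = M)"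

definition coset :: "real set \<Rightarrow> real \<Rightarrow> real set" where
  "coset L x = (+) x ` L"

definition quotient_space :: "real set \<Rightarrow> real set topology" where
  "quotient_space L = topology (\<lambda>U. U \<subseteq> range (coset L) \<and> open {x. coset L x \<in> U})"

lemma openin_quotient_space:
  "openin (quotient_space L) U \<longleftrightarrow> U \<subseteq> range (coset L) \<and> open {x. coset L x \<in> U}"
proof -
  let ?P = "\<lambda>U. U \<subseteq> range (coset L) \<and> open {x. coset L x \<in> U}"
  have "istopology ?P"
    unfolding istopology_def
  proof (intro conjI allI impI)
    fix S U assume S: "?P S" and U: "?P U"
    show "S \<inter> U \<subseteq> range (coset L)" using S by blast
    have "{x. coset L x \<in> S \<inter> U} = {x. coset L x \<in> S} \<inter> {x. coset L x \<in> U}" by blast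
    then show "open {x. coset L x \<in> S \<inter> U}" using S U by (metis open_Int)
  next
    fix K assume K: "\<forall>S\<in>K. ?P S"
    show "\<Union>K \<subseteq> range (coset L)" using K by blast
    have "{x. coset L x \<in> \<Union>K} = (\<Union>S\<in>K. {x. coset L x \<in> S})" by blast
    then show "open {x. coset L x \<in> \<Union>K}" using K by (metis (no_types, lifting) open_UN)
  qed
  then show ?thesis
    unfolding quotient_space_def by (simp add: topology_inverse')
qed

lemma topspace_quotient_space: "topspace (quotient_space L) = range (coset L)"
proof
  show "topspace (quotient_space L) \<subseteq> range (coset L)"
    using openin_quotient_space openin_topspace by blast
  have "{x. coset L x \<in> range (coset L)} = UNIV" by blast
  then have "openin (quotient_space L) (range (coset L))"
    by (simp add: openin_quotient_space)
  then show "range (coset L) \<subseteq> topspace (quotient_space L)"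
    by (rule openin_subset)
qed

lemma quotient_map_coset: "quotient_map euclidean (quotient_space L) (coset L)"
  by (simp add: quotient_map_def topspace_quotient_space openin_quotient_space)

text \<open>
  Descent to the quotient evaluates at an arbitrary representative; this is the induced map
  for periodic functions (\<open>descend_coset\<close>, \<open>descend2_coset\<close>).
\<close>

definition descend :: "(real \<Rightarrow> 'a) \<Rightarrow> real set \<Rightarrow> 'a" where
  "descend f = (\<lambda>c. f (SOME x. x \<in> c))"

definition descend2 :: "(real \<Rightarrow> real \<Rightarrow> 'a) \<Rightarrow> real set \<times> real set \<Rightarrow> 'a" where
  "descend2 f = (\<lambda>(c, d). f (SOME x. x \<in> c) (SOME t. t \<in> d))"

lemma representative_coset:
  assumes "L \<noteq> {}"
  obtains l where "l \<in> L" "(SOME y. y \<in> coset L x) = x + l"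
proof -
  have "\<exists>y. y \<in> coset L x" using assms by (auto simp: coset_def)
  then have "(SOME y. y \<in> coset L x) \<in> coset L x" by (rule someI_ex)
  then show thesis using that by (auto simp: coset_def)
qed

lemma descend_coset:
  assumes "L \<noteq> {}" "periodic_mod L f"
  shows "descend f (coset L x) = f x"
  using representative_coset[OF assms(1), of x] assms(2)
  by (metis descend_def periodic_mod_def)

lemma descend2_coset:
  assumes "L \<noteq> {}" "M \<noteq> {}" "periodic_mod L f" "\<And>x. periodic_mod M (f x)"
  shows "descend2 f (coset L x, coset M t) = f x t"
proof -
  obtain l where l: "l \<in> L" "(SOME y. y \<in> coset L x) = x + l"
    using representative_coset[OF assms(1)] .
  obtain m where m: "m \<in> M" "(SOME y. y \<in> coset M t) = t + m"
    using representative_coset[OF assms(2)] .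
  show ?thesis
    using l m assms(3,4) by (simp add: descend2_def periodic_mod_def)
qed

definition CP :: "(complex ^ 'n) set set" where
  "CP = {l. vec.subspace l \<and> vec.dim l = 1}"

text \<open>
  The standard affine charts: on the lines not contained in the hyperplane where the
  \<open>i\<close>-th coordinate vanishes, the chart takes the line of \<open>z\<close> to \<open>z / z\<^sub>i\<close>
  (the \<open>i\<close>-th entry, which is constantly \<open>1\<close>, is kept).
\<close>

definition chart_domain :: "'n \<Rightarrow> (complex ^ 'n) set set" where
  "chart_domain i = {l \<in> CP. \<exists>v\<in>l. v $ i \<noteq> 0}"

definition affine_chart :: "'n \<Rightarrow> (complex ^ 'n) set \<Rightarrow> complex ^ 'n" where
  "affine_chart i l = (THE v. v \<in> l \<and> v $ i = 1)"

definition C1_into_CP :: "(real \<Rightarrow> (complex ^ 'n) set) \<Rightarrow> real set \<Rightarrow> bool" where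
  "C1_into_CP eta W \<longleftrightarrow>
     (\<forall>x\<in>W. \<exists>i U. open U \<and> x \<in> U \<and> U \<subseteq> W \<and> eta ` U \<subseteq> chart_domain i \<and>
        (\<lambda>y. affine_chart i (eta y)) C1_differentiable_on U)"

text \<open>
  As the lines span, the \<open>lam n\<close> are all the eigenvalues of \<open>M\<close>, repeated according to their
  multiplicities; \<open>eta n\<close> is a line inside the eigenspace of \<open>lam n\<close>, and all of it if
  \<open>lam n\<close> is simple.
\<close>

definition eigenline_system ::
  "complex ^ 'n ^ 'n \<Rightarrow> ('n \<Rightarrow> complex) \<Rightarrow> ('n \<Rightarrow> (complex ^ 'n) set) \<Rightarrow> bool" where
  "eigenline_system M lam eta \<longleftrightarrow>
     (\<forall>n. eta n \<in> CP \<and> (\<forall>v\<in>eta n. M *v v = lam n *s v)) \<and>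
     vec.span (\<Union>n. eta n) = UNIV"

definition C1_diagonalization ::
  "(real \<Rightarrow> complex ^ 'n ^ 'n) \<Rightarrow> real set \<Rightarrow>
   ('n \<Rightarrow> real \<Rightarrow> complex) \<Rightarrow> ('n \<Rightarrow> real \<Rightarrow> (complex ^ 'n) set) \<Rightarrow> bool" where
  "C1_diagonalization M W lam eta \<longleftrightarrow>
     (\<forall>n. lam n C1_differentiable_on W) \<and> (\<forall>n. C1_into_CP (eta n) W) \<and>
     (\<forall>x\<in>W. eigenline_system (M x) (\<lambda>n. lam n x) (\<lambda>n. eta n x))"

definition locally_C1_diagonalizable :: "(real \<Rightarrow> complex ^ 'n ^ 'n) \<Rightarrow> bool" where
  "locally_C1_diagonalizable M \<longleftrightarrow>
     (\<forall>x. \<exists>W lam eta. open W \<and> x \<in> W \<and> C1_diagonalization M W lam eta)"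

definition C1_matrix_field :: "(real \<times> real \<Rightarrow> complex ^ 'n ^ 'n) \<Rightarrow> bool" where
  "C1_matrix_field A \<longleftrightarrow>
     (\<exists>A'. (\<forall>p. (A has_derivative blinfun_apply (A' p)) (at p)) \<and> continuous_on UNIV A')"

definition fundamental_solution ::
  "(real \<times> real \<Rightarrow> complex ^ 'n ^ 'n) \<Rightarrow> (real \<Rightarrow> real \<Rightarrow> complex ^ 'n ^ 'n) \<Rightarrow> bool" where
  "fundamental_solution A X \<longleftrightarrow>
     (\<forall>g. X g 0 = mat 1 \<and>
        (\<forall>t. (X g has_vector_derivative (A (g, t) ** X g t)) (at t)))"

text \<open>
  The library's \<^const>\<open>exp\<close> is not available on square matrices, whose type carries
  the entrywise product.
\<close>

definition mat_exp :: "complex ^ 'n ^ 'n \<Rightarrow> complex ^ 'n ^ 'n" where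
  "mat_exp M = (\<Sum>k. (1 / fact k) *\<^sub>R (((**) M ^^ k) (mat 1)))"

definition diag_mat :: "('n \<Rightarrow> complex) \<Rightarrow> complex ^ 'n ^ 'n" where
  "diag_mat d = (\<chi> i j. if i = j then d i else 0)"

definition floquet_exponent_matrix ::
  "('n \<Rightarrow> real \<Rightarrow> complex) \<Rightarrow> (real \<Rightarrow> complex ^ 'n ^ 'n) \<Rightarrow> real \<Rightarrow> complex ^ 'n ^ 'n" where
  "floquet_exponent_matrix mu V g = V g ** diag_mat (\<lambda>n. mu n g) ** matrix_inv (V g)"

definition lyapunov_transform ::
  "(real \<Rightarrow> real \<Rightarrow> complex ^ 'n ^ 'n) \<Rightarrow> ('n \<Rightarrow> real \<Rightarrow> complex) \<Rightarrow>
   (real \<Rightarrow> complex ^ 'n ^ 'n) \<Rightarrow> real \<Rightarrow> real \<Rightarrow> complex ^ 'n ^ 'n" where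
  "lyapunov_transform X mu V g t = X g t ** mat_exp (- t *\<^sub>R floquet_exponent_matrix mu V g)"

text \<open>
  The parameterized equation with its Floquet data: multipliers \<open>lam\<close>, eigenlines \<open>eta\<close>,
  maximal period lattices \<open>Ln\<close> of the multipliers, exponents \<open>mu\<close>, and a matrix \<open>V\<close> of
  eigenvectors. The period lattice of a multiplier need not be one of its eigenline where
  eigenvalues coincide, so periodicity of \<open>eta n\<close> is a separate condition. No regularity or
  periodicity of \<open>V\<close> is required.
\<close>

locale floquet_data =
  fixes L :: "real set" and T :: real
    and A :: "real \<times> real \<Rightarrow> complex ^ 'n ^ 'n"
    and X :: "real \<Rightarrow> real \<Rightarrow> complex ^ 'n ^ 'n"
    and lam :: "'n \<Rightarrow> real \<Rightarrow> complex"
    and eta :: "'n \<Rightarrow> real \<Rightarrow> (complex ^ 'n) set"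
    and Ln :: "'n \<Rightarrow> real set"
    and mu :: "'n \<Rightarrow> real \<Rightarrow> complex"
    and V :: "real \<Rightarrow> complex ^ 'n ^ 'n"
  assumes lattice: "is_lattice L"
    and C1_coefficients: "C1_matrix_field A"
    and periodic_parameter: "\<And>t. periodic_mod L (\<lambda>g. A (g, t))"
    and periodic_time: "\<And>g t. A (g, t + T) = A (g, t)"
    and solution: "fundamental_solution A X"
    and local_diagonalizability: "locally_C1_diagonalizable (\<lambda>g. X g T)"
    and diagonalization: "C1_diagonalization (\<lambda>g. X g T) UNIV lam eta"
    and multiplier_lattice: "\<And>n. maximal_period_lattice L (lam n) (Ln n)"
    and eigenline_periodic: "\<And>n. periodic_mod (Ln n) (eta n)"
    and C1_exponents: "\<And>n. mu n C1_differentiable_on UNIV"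
    and exponents: "\<And>n g. exp (of_real T * mu n g) = lam n g"
    and eigenvectors: "\<And>n g. column n (V g) \<in> eta n g \<and> column n (V g) \<noteq> 0"

definition trivial_multiplier_class :: "real set \<Rightarrow> (real \<Rightarrow> complex) \<Rightarrow> bool" where
  "trivial_multiplier_class M f \<longleftrightarrow>
     (\<exists>c. homotopic_with (\<lambda>_. True) (quotient_space M) (top_of_set (- {0}))
        (descend f) (\<lambda>_. c))"

definition GL :: "(complex ^ 'n ^ 'n) set" where
  "GL = {M. invertible M}"

definition Delta :: "complex ^ 'n ^ 'n \<Rightarrow> complex" where
  "Delta M = det M / of_real (norm (det M))"

definition iota :: "real set \<Rightarrow> real set \<Rightarrow> real set \<times> real set" where
  "iota K tbar = (coset K 0, tbar)"

end

theory Submission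
  imports Defs
begin

text \<open>
  Triviality of the multiplier classes makes the exponents periodic, so the Lyapunov transform is a
  map from the torus to \<open>GL\<^sub>N(\<complex>)\<close> which is \<open>Id\<close> on the circle \<open>t = 0\<close>. Two maps from the torus to
  \<open>GL\<^sub>N(\<complex>)\<close> are homotopic as soon as their determinants are homotopic in \<open>\<complex>\<^sup>*\<close>: a column, regarded as
  a map into \<open>\<complex>\<^sup>m - {0}\<close> with \<open>m \<ge> 2\<close>, is close to a polynomial one, whose real multiples miss a
  direction for reasons of dimension; it can therefore be moved to a constant, the rest of the matrix
  is carried along by a rotation, and after clearing the row one goes on with the next column until
  only the determinant is left. Finally, the quotient of the determinants of two Lyapunov transforms
  has a logarithm on the plane. Its increments along the two periods are constants that can be read
  off on the two axes: one vanishes because the quotient is \<open>1\<close> for \<open>t = 0\<close>, the other one by the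
  assumption on \<open>\<Delta> \<circ> P \<circ> \<iota>\<close>. So the logarithm lives on the torus.
\<close>

text \<open>The obstacle to moving a column to a constant is antipodality: two directions are joined
  by a straight segment unless they are opposite, and a merely continuous map from a surface may
  take every direction. For a polynomial column over a differentiable surface this cannot happen:
  its real multiples depend on three real parameters, while \<open>m \<ge> 2\<close> complex
  coordinates give at least four real ones. The count fails for \<open>m = 1\<close>, which is why
  the determinant survives as the invariant. Since approximation and dimension count belong to
  Euclidean space, the torus is used as a compact subset of the complex plane squared, parameterized
  differentiably by the real plane, and homotopies are pulled back from there to the product of
  quotients. A second obstacle is that the eigenvector matrix \<open>V\<close> may vary wildly with
  the parameter. The Floquet exponent matrix depends on \<open>V\<close> only through the lines
  spanned by its columns, so continuity and periodicity can be checked with any other choice of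
  eigenvectors.\<close>

lemma bounded_bilinear_matrix_mult:
  "bounded_bilinear ((**) :: complex ^ 'n ^ 'm \<Rightarrow> complex ^ 'p ^ 'n \<Rightarrow> complex ^ 'p ^ 'm)"
  unfolding bilinear_conv_bounded_bilinear[symmetric] bilinear_def
  by (auto intro!: linearI simp: matrix_matrix_mult_def vec_eq_iff sum.distrib algebra_simps scaleR_sum_right)

lemma bounded_bilinear_matrix_vector_mult:
  "bounded_bilinear ((*v) :: complex ^ 'n ^ 'm \<Rightarrow> complex ^ 'n \<Rightarrow> complex ^ 'm)"
  unfolding bilinear_conv_bounded_bilinear[symmetric] bilinear_def
  by (auto intro!: linearI simp: matrix_vector_mult_def vec_eq_iff sum.distrib algebra_simps scaleR_sum_right)

lemmas continuous_on_matrix_mult [continuous_intros] =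
  bounded_bilinear.continuous_on[OF bounded_bilinear_matrix_mult]

lemma continuous_on_det [continuous_intros]:
  fixes f :: "'a::topological_space \<Rightarrow> complex ^ 'n ^ 'n"
  assumes "continuous_on S f"
  shows "continuous_on S (\<lambda>x. det (f x))"
  unfolding det_def by (intro continuous_intros assms)

lemma continuous_on_matrix_entries:
  fixes f :: "'a::topological_space \<Rightarrow> complex ^ 'n ^ 'm"
  assumes "\<And>i j. continuous_on S (\<lambda>x. f x $ i $ j)"
  shows "continuous_on S f"
proof -
  have "continuous_on S (\<lambda>x. \<chi> i j. f x $ i $ j)"
    by (intro continuous_intros assms)
  then show ?thesis by simp
qed

lemma matrix_inv_mult:
  fixes M :: "complex ^ 'n ^ 'n"
  assumes "invertible M"
  shows "M ** matrix_inv M = mat 1" "matrix_inv M ** M = mat 1"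
  using someI_ex[OF assms[unfolded invertible_def]] by (auto simp: matrix_inv_def)

text \<open>Cramer's rule, applied to the columns of the inverse, makes every entry a quotient of
  two determinants.\<close>

lemma continuous_on_matrix_inv [continuous_intros]:
  fixes f :: "'a::topological_space \<Rightarrow> complex ^ 'n ^ 'n"
  assumes f: "continuous_on S f" and inv: "\<And>x. x \<in> S \<Longrightarrow> invertible (f x)"
  shows "continuous_on S (\<lambda>x. matrix_inv (f x))"
proof (rule continuous_on_matrix_entries)
  fix i j
  have nz: "det (f x) \<noteq> 0" if "x \<in> S" for x
    using inv[OF that] by (simp add: invertible_det_nz)
  have "matrix_inv (f x) $ i $ j
      = det (\<chi> k l. if l = i then axis j 1 $ k else f x $ k $ l) / det (f x)" if "x \<in> S" for x
  proof -
    have "f x *v column j (matrix_inv (f x)) = axis j 1"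
      using matrix_inv_mult(1)[OF inv[OF that]]
      by (simp add: vec_eq_iff matrix_vector_mult_def column_def matrix_matrix_mult_def mat_def axis_def)
    from this[unfolded cramer[OF nz[OF that]]] have "column j (matrix_inv (f x)) $ i
        = det (\<chi> k l. if l = i then axis j 1 $ k else f x $ k $ l) / det (f x)"
      by simp
    then show ?thesis by (simp add: column_def)
  qed
  moreover have "continuous_on S (\<lambda>x. if l = i then axis j 1 $ k else f x $ k $ l)" for k l
    by (cases "l = i") (auto intro!: continuous_intros f)
  ultimately show "continuous_on S (\<lambda>x. matrix_inv (f x) $ i $ j)"
    by (subst continuous_on_cong[OF refl]) (auto intro!: continuous_intros f nz)
qed

lemma invertible_iff_trivial_kernel:
  fixes M :: "complex ^ 'n ^ 'n"
  shows "invertible M \<longleftrightarrow> (\<forall>x. M *v x = 0 \<longrightarrow> x = 0)"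
  by (metis invertible_left_inverse matrix_left_invertible_ker)

lemma GL_eq_det: "GL = {M :: complex ^ 'n ^ 'n. det M \<noteq> 0}"
  by (simp add: GL_def invertible_det_nz)

section \<open>Rotations\<close>

text \<open>The standard Hermitian form; the first slot is the antilinear one, so that
  \<open>hdot v\<close> is a complex linear functional.\<close>

definition hdot :: "complex ^ 'n \<Rightarrow> complex ^ 'n \<Rightarrow> complex" where
  "hdot v w = (\<Sum>i\<in>UNIV. cnj (v $ i) * w $ i)"

lemma hdot_linear:
  "hdot v (x + y) = hdot v x + hdot v y" "hdot (v + w) x = hdot v x + hdot w x"
  "hdot v (c *s x) = c * hdot v x" "hdot v (x - y) = hdot v x - hdot v y" "hdot v 0 = 0"
  by (simp_all add: hdot_def algebra_simps sum.distrib sum_distrib_left sum_subtractf)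

lemma hdot_self: "hdot v v = of_real ((norm v)\<^sup>2)"
  unfolding hdot_def norm_vec_def L2_set_def
  by (subst real_sqrt_pow2) (auto simp: sum_nonneg complex_norm_square mult.commute simp del: of_real_power)

text \<open>
  Meant for unit vectors with \<open>hdot w v \<noteq> -1\<close>. The formula extends the real one, the composition of
  the reflections in the hyperplanes orthogonal to \<open>v\<close> and to \<open>v + w\<close>; over \<open>\<complex>\<close> it is in general
  not unitary, only invertible.
\<close>

definition rotation :: "complex ^ 'n \<Rightarrow> complex ^ 'n \<Rightarrow> complex ^ 'n ^ 'n" where
  "rotation v w = (\<chi> i j. (if i = j then 1 else 0)
     - (v $ i + w $ i) * cnj (v $ j + w $ j) / (1 + hdot w v) + 2 * w $ i * cnj (v $ j))"

lemma rotation_mult_vec: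
  "rotation v w *v x
     = x - (hdot (v + w) x / (1 + hdot w v)) *s (v + w) + (2 * hdot v x) *s w"
proof (subst vec_eq_iff, rule allI)
  fix i
  have "(rotation v w *v x) $ i = (\<Sum>j\<in>UNIV. (if i = j then 1 else 0) * x $ j)
     - (\<Sum>j\<in>UNIV. (v $ i + w $ i) / (1 + hdot w v) * (cnj ((v + w) $ j) * x $ j))
     + (\<Sum>j\<in>UNIV. 2 * w $ i * (cnj (v $ j) * x $ j))"
    unfolding sum_subtractf[symmetric] sum.distrib[symmetric] matrix_vector_mult_def rotation_def
    by (simp add: field_simps)
  also have "\<dots> = x $ i - (v $ i + w $ i) / (1 + hdot w v) * hdot (v + w) x + 2 * w $ i * hdot v x"
    unfolding sum_distrib_left[symmetric] hdot_def[symmetric]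
    by (simp add: if_distrib[of "\<lambda>c. c * _"] cong: if_cong)
  finally show "(rotation v w *v x) $ i =
      (x - (hdot (v + w) x / (1 + hdot w v)) *s (v + w) + (2 * hdot v x) *s w) $ i"
    by (simp add: algebra_simps add_divide_distrib)
qed

lemma rotation_maps:
  assumes "norm v = 1" "hdot w v \<noteq> -1"
  shows "rotation v w *v v = w"
proof -
  have "1 + hdot w v \<noteq> 0" using assms(2) by (metis add_eq_0_iff)
  then show ?thesis using assms(1)
    by (simp add: rotation_mult_vec hdot_linear hdot_self vec_eq_iff)
qed

lemma rotation_same:
  assumes "norm v = 1"
  shows "rotation v v = mat 1"
  using assms by (auto simp: rotation_def hdot_self mat_def vec_eq_iff)

text \<open>A kernel vector is a combination of \<open>v + w\<close> and \<open>w\<close> with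
  coefficients given by \<open>a\<close> and \<open>b\<close>. Pairing it with \<open>w\<close>
  forces \<open>b = 0\<close>; pairing it with \<open>v\<close> then forces \<open>a = 0\<close>,
  because \<open>1 + hdot v w\<close> is the conjugate of the nonzero number
  \<open>c\<close>.\<close>

lemma invertible_rotation:
  assumes v: "norm v = 1" and w: "norm w = 1" and vw: "hdot w v \<noteq> -1"
  shows "invertible (rotation v w)"
  unfolding invertible_iff_trivial_kernel
proof (intro allI impI)
  fix x assume "rotation v w *v x = 0"
  define c a b where "c = 1 + hdot w v" and "a = hdot (v + w) x" and "b = hdot v x"
  have c: "c \<noteq> 0" using vw by (metis add_eq_0_iff c_def)
  have cnj: "hdot v w = cnj (hdot w v)"
    by (simp add: hdot_def mult.commute)
  have "cnj c \<noteq> 0" using c by simp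
  then have c': "1 + hdot v w \<noteq> 0" by (simp add: c_def cnj)
  have x: "x = (a / c) *s (v + w) - (2 * b) *s w"
    using \<open>rotation v w *v x = 0\<close> unfolding rotation_mult_vec a_def b_def c_def
    by (simp add: algebra_simps add_eq_0_iff)
  have "hdot w x = a / c * c - 2 * b"
  proof -
    have "hdot w (v + w) = c" by (simp add: hdot_linear hdot_self w c_def)
    then show ?thesis
      using arg_cong[OF x, of "hdot w"] unfolding hdot_linear(3,4) by (simp add: hdot_self w)
  qed
  then have "a - b = a - 2 * b" using c by (simp add: a_def b_def hdot_linear)
  then have b: "b = 0" by simp
  have "b = a / c * (1 + hdot v w) - 2 * b * hdot v w"
  proof -
    have "hdot v (v + w) = 1 + hdot v w" by (simp add: hdot_linear hdot_self v)
    then show ?thesis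
      using arg_cong[OF x, of "hdot v"] unfolding hdot_linear(3,4) by (simp flip: b_def)
  qed
  then have a: "a = 0" using b c c' by simp
  show "x = 0" by (subst x) (simp add: a b)
qed

section \<open>Maps from surfaces to the general linear group\<close>

definition supported :: "'n set \<Rightarrow> complex ^ 'n \<Rightarrow> bool" where
  "supported J v \<longleftrightarrow> (\<forall>i. i \<notin> J \<longrightarrow> v $ i = 0)"

text \<open>The block inclusion of a smaller general linear group. The size of a matrix is fixed by
  its type, so the induction on the size shrinks the index set \<open>J\<close> instead.\<close>

definition trivial_outside :: "'n set \<Rightarrow> complex ^ 'n ^ 'n \<Rightarrow> bool" where
  "trivial_outside J M \<longleftrightarrow>
     (\<forall>i k. i \<notin> J \<longrightarrow> M $ i $ k = mat 1 $ i $ k \<and> M $ k $ i = mat 1 $ k $ i)"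

lemma trivial_outside_column:
  "trivial_outside J M \<Longrightarrow> j \<in> J \<Longrightarrow> supported J (column j M)"
  by (auto simp: trivial_outside_def supported_def column_def mat_def)

lemma trivial_outside_mult:
  assumes "trivial_outside J M" "trivial_outside J N"
  shows "trivial_outside J (M ** N)"
  using assms
  by (auto simp: trivial_outside_def matrix_matrix_mult_def mat_def if_distrib[of "\<lambda>c. c * _"]
      if_distrib[of "\<lambda>c. _ * c"] cong: if_cong)

lemma trivial_outside_rotation:
  assumes "supported J v" "supported J w"
  shows "trivial_outside J (rotation v w)"
  using assms by (auto simp: trivial_outside_def supported_def rotation_def mat_def)

lemma continuous_on_hdot [continuous_intros]:
  assumes "continuous_on S f" "continuous_on S g"
  shows "continuous_on S (\<lambda>x. hdot (f x) (g x))"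
  unfolding hdot_def by (intro continuous_intros assms)

lemma continuous_on_rotation [continuous_intros]:
  assumes "continuous_on S f" "continuous_on S g" "\<And>x. x \<in> S \<Longrightarrow> hdot (g x) (f x) \<noteq> -1"
  shows "continuous_on S (\<lambda>x. rotation (f x) (g x))"
  unfolding rotation_def using assms(3)
  by (intro continuous_intros assms) (auto simp: add_eq_0_iff)

text \<open>The equality case of the Cauchy-Schwarz inequality. For unit vectors the denominator of
  \<open>rotation\<close> thus vanishes only at antipodal pairs.\<close>

lemma hdot_eq_minus_one:
  assumes "norm v = 1" "norm w = 1" "hdot w v = -1"
  shows "v + w = 0"
proof -
  have "hdot v w = cnj (hdot w v)"
    by (simp add: hdot_def mult.commute)
  moreover have "hdot v v = 1" "hdot w w = 1"
    using assms by (simp_all add: hdot_self)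
  ultimately have "hdot (v + w) (v + w) = 0"
    using assms by (simp add: hdot_linear(1,2))
  then have "complex_of_real ((norm (v + w))\<^sup>2) = 0" by (simp only: hdot_self)
  then show ?thesis by simp
qed

lemma homotopic_withI:
  assumes "continuous_on ({0..1} \<times> S) (\<lambda>y. h (fst y) (snd y))"
    and "\<And>s x. s \<in> {0..1::real} \<Longrightarrow> x \<in> S \<Longrightarrow> h s x \<in> T"
    and "\<And>x. x \<in> S \<Longrightarrow> h 0 x = f x" "\<And>x. x \<in> S \<Longrightarrow> h 1 x = g x"
  shows "homotopic_with_canon (\<lambda>_. True) S T f g"
  by (subst homotopic_with, blast, rule exI[of _ "\<lambda>y. h (fst y) (snd y)"])
    (use assms in \<open>auto simp: continuous_map_in_subtopology\<close>)

text \<open>Left multiplication by the rotation from the direction of the column to that of a point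
  on the segment towards \<open>u x\<close> carries the whole matrix along and starts at the
  identity. Directions alone are controlled, hence the factor \<open>c x\<close>. The hypothesis
  \<open>not_opposite\<close> keeps the segment away from 0 and from the negative multiples of the
  column.\<close>

lemma rotate_column:
  fixes M :: "'a::real_normed_vector \<Rightarrow> complex ^ 'n ^ 'n"
  assumes M: "continuous_on S M" "M \<in> S \<rightarrow> GL" "\<And>x. x \<in> S \<Longrightarrow> trivial_outside J (M x)" and "j \<in> J"
    and u: "continuous_on S u" "\<And>x. x \<in> S \<Longrightarrow> supported J (u x)"
    and not_opposite: "\<And>x a b. x \<in> S \<Longrightarrow> 0 \<le> a \<Longrightarrow> 0 \<le> b \<Longrightarrow>
      a *\<^sub>R column j (M x) + b *\<^sub>R u x = 0 \<Longrightarrow> a = 0 \<and> b = 0"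
  obtains M' c where "homotopic_with_canon (\<lambda>_. True) S GL M M'"
    "\<And>x. x \<in> S \<Longrightarrow> trivial_outside J (M' x)"
    "\<And>x. x \<in> S \<Longrightarrow> c x > (0::real) \<and> column j (M' x) = c x *\<^sub>R u x"
proof -
  define v where "v x = column j (M x)" for x
  define z where "z s x = (1 - s) *\<^sub>R v x + s *\<^sub>R u x" for s x
  define R where "R s x = rotation (v x /\<^sub>R norm (v x)) (z s x /\<^sub>R norm (z s x))" for s x
  have z0: "z s x \<noteq> 0" if "x \<in> S" "s \<in> {0..1}" for s x
    using not_opposite[OF that(1), of "1 - s" s] that(2) by (auto simp: z_def v_def)
  have v0: "v x \<noteq> 0" if "x \<in> S" for x
    using z0[OF that, of 0] by (simp add: z_def)
  have u0: "u x \<noteq> 0" if "x \<in> S" for x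
    using z0[OF that, of 1] by (simp add: z_def)
  \<comment> \<open>An antipodal pair would give a vanishing combination of \<open>v x\<close> and
    \<open>u x\<close> with nonnegative coefficients, the first of them positive.\<close>
  have nz: "hdot (z s x /\<^sub>R norm (z s x)) (v x /\<^sub>R norm (v x)) \<noteq> -1" if "x \<in> S" "s \<in> {0..1}" for s x
  proof
    assume "hdot (z s x /\<^sub>R norm (z s x)) (v x /\<^sub>R norm (v x)) = -1"
    with v0[OF that(1)] z0[OF that] have "v x /\<^sub>R norm (v x) + z s x /\<^sub>R norm (z s x) = 0"
      by (intro hdot_eq_minus_one) auto
    then have "(inverse (norm (v x)) + inverse (norm (z s x)) * (1 - s)) *\<^sub>R v x
        + (inverse (norm (z s x)) * s) *\<^sub>R u x = 0"
      by (simp add: z_def algebra_simps)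
    then have "inverse (norm (v x)) + inverse (norm (z s x)) * (1 - s) = 0"
      using that(2) unfolding v_def by (intro not_opposite[OF that(1), THEN conjunct1]) auto
    moreover have "inverse (norm (v x)) > 0" "inverse (norm (z s x)) * (1 - s) \<ge> 0"
      using v0[OF that(1)] that(2) by auto
    ultimately show False by linarith
  qed
  have unit: "norm (v x /\<^sub>R norm (v x)) = 1" "norm (z s x /\<^sub>R norm (z s x)) = 1"
    if "x \<in> S" "s \<in> {0..1}" for s x
    using v0[OF that(1)] z0[OF that] by auto
  have R: "invertible (R s x)" if "x \<in> S" "s \<in> {0..1}" for s x
    unfolding R_def using unit[OF that] nz[OF that] by (intro invertible_rotation)
  have cv: "continuous_on S v"
    unfolding v_def column_def by (intro continuous_intros M)
  have cv': "continuous_on ({0..1::real} \<times> S) (\<lambda>y. v (snd y))"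
    by (rule continuous_on_compose2[OF cv]) (auto intro!: continuous_intros)
  have cu': "continuous_on ({0..1::real} \<times> S) (\<lambda>y. u (snd y))"
    by (rule continuous_on_compose2[OF u(1)]) (auto intro!: continuous_intros)
  have cM': "continuous_on ({0..1::real} \<times> S) (\<lambda>y. M (snd y))"
    by (rule continuous_on_compose2[OF M(1)]) (auto intro!: continuous_intros)
  have cz': "continuous_on ({0..1::real} \<times> S) (\<lambda>y. z (fst y) (snd y))"
    unfolding z_def by (intro continuous_intros cv' cu')
  have cR: "continuous_on ({0..1::real} \<times> S) (\<lambda>y. R (fst y) (snd y))"
    unfolding R_def using v0 z0 nz by (intro continuous_intros cv' cz') auto
  have "homotopic_with_canon (\<lambda>_. True) S GL M (\<lambda>x. R 1 x ** M x)"
  proof (rule homotopic_withI[where h = "\<lambda>s x. R s x ** M x"])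
    show "continuous_on ({0..1} \<times> S) (\<lambda>y. R (fst y) (snd y) ** M (snd y))"
      by (intro continuous_intros cR cM')
    show "R s x ** M x \<in> GL" if "s \<in> {0..1}" "x \<in> S" for s x
      using M(2) R[OF that(2,1)] that by (auto simp: GL_def intro!: invertible_mult)
    show "R 0 x ** M x = M x" if "x \<in> S" for x
      using unit(1)[OF that, of 0] by (simp add: R_def z_def rotation_same)
  qed simp
  moreover have "trivial_outside J (R 1 x ** M x)" if "x \<in> S" for x
    unfolding R_def using that M(3) u(2) trivial_outside_column[OF M(3) \<open>j \<in> J\<close>]
    by (intro trivial_outside_mult trivial_outside_rotation) (auto simp: supported_def v_def z_def)
  moreover have "norm (v x) / norm (u x) > 0 \<and>
      column j (R 1 x ** M x) = (norm (v x) / norm (u x)) *\<^sub>R u x" if "x \<in> S" for x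
  proof -
    have "column j (R 1 x ** M x) = R 1 x *v v x"
      by (simp add: v_def column_def matrix_matrix_mult_def matrix_vector_mult_def vec_eq_iff)
    also have "\<dots> = norm (v x) *\<^sub>R (R 1 x *v (v x /\<^sub>R norm (v x)))"
      using v0[OF that] by (simp add: bounded_bilinear.scaleR_right[OF bounded_bilinear_matrix_vector_mult])
    also have "R 1 x *v (v x /\<^sub>R norm (v x)) = z 1 x /\<^sub>R norm (z 1 x)"
      unfolding R_def using unit(1)[of x 1] nz[of x 1] that by (intro rotation_maps) auto
    also have "z 1 x = u x" by (simp add: z_def)
    finally show ?thesis
      using v0[OF that] u0[OF that] by (simp add: field_simps)
  qed
  ultimately show thesis by (rule that)
qed

text \<open>When column \<open>j\<close> is a multiple of \<open>axis j 1\<close>, the determinant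
  involves row \<open>j\<close> only through its diagonal entry. The rest of that row can therefore
  be shrunk to 0 while the diagonal entry moves to 1 through positive numbers.\<close>

lemma clear_column:
  fixes M :: "'a::real_normed_vector \<Rightarrow> complex ^ 'n ^ 'n"
  assumes M: "continuous_on S M" "M \<in> S \<rightarrow> GL" "\<And>x. x \<in> S \<Longrightarrow> trivial_outside J (M x)" and "j \<in> J"
    and col: "\<And>x. x \<in> S \<Longrightarrow> c x > (0::real) \<and> column j (M x) = c x *\<^sub>R axis j 1"
  obtains M' where "homotopic_with_canon (\<lambda>_. True) S GL M M'"
    "\<And>x. x \<in> S \<Longrightarrow> trivial_outside (J - {j}) (M' x)"
proof -
  define H :: "real \<times> 'a \<Rightarrow> complex ^ 'n ^ 'n" where
    "H y = (\<chi> i k. if i = j then (1 - fst y) *\<^sub>R M (snd y) $ j $ k + fst y *\<^sub>R (if k = j then 1 else 0)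
       else M (snd y) $ i $ k)" for y
  have Mj: "M x $ i $ j = (if i = j then of_real (c x) else 0)" if "x \<in> S" for x i
    using arg_cong[OF col[OF that, THEN conjunct2], of "\<lambda>v. v $ i"]
    by (auto simp: column_def axis_def of_real_def split: if_splits)
  have cM: "continuous_on ({0..1::real} \<times> S) (\<lambda>y. M (snd y))"
    by (rule continuous_on_compose2[OF M(1)]) (auto intro!: continuous_intros)
  have cH: "continuous_on ({0..1} \<times> S) H"
  proof (rule continuous_on_matrix_entries)
    fix i k
    show "continuous_on ({0..1} \<times> S) (\<lambda>y. H y $ i $ k)"
      by (cases "i = j") (auto simp: H_def intro!: continuous_intros cM)
  qed
  have inv: "invertible (H (s, x))" if "x \<in> S" "s \<in> {0..1}" for s x
    unfolding invertible_iff_trivial_kernel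
  proof (intro allI impI)
    fix y assume "H (s, x) *v y = 0"
    then have Hy: "(\<Sum>k\<in>UNIV. H (s, x) $ i $ k * y $ k) = 0" for i
      by (simp add: matrix_vector_mult_def vec_eq_iff)
    \<comment> \<open>The rows other than \<open>j\<close> do not see coordinate \<open>j\<close>,
      so it may be altered there; the new value is the one for which row \<open>j\<close> of
      \<open>M x\<close> vanishes as well.\<close>
    define y' where "y' = (\<chi> k. if k = j then - (\<Sum>l\<in>UNIV-{j}. M x $ j $ l * y $ l) / of_real (c x) else y $ k)"
    have "(\<Sum>k\<in>UNIV. M x $ i $ k * y' $ k) = 0" for i
    proof (cases "i = j")
      case True
      then show ?thesis using col[OF that(1)] Mj[OF that(1)]
        by (simp add: sum.remove[of UNIV j] y'_def)
    next
      case False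
      then show ?thesis using Hy[of i] Mj[OF that(1)]
        by (simp add: sum.remove[of UNIV j] y'_def H_def)
    qed
    then have "M x *v y' = 0" by (simp add: matrix_vector_mult_def vec_eq_iff)
    moreover have "invertible (M x)" using M(2) that(1) by (auto simp: GL_def)
    ultimately have "y' = 0" by (simp add: invertible_iff_trivial_kernel)
    then have y: "y $ k = 0" if "k \<noteq> j" for k
      using that by (auto simp: y'_def vec_eq_iff split: if_splits dest: spec[of _ k])
    have "H (s, x) $ j $ j * y $ j = 0"
      using Hy[of j] y by (simp add: sum.remove[of UNIV j])
    moreover have "H (s, x) $ j $ j = of_real ((1 - s) * c x + s)"
      using Mj[OF that(1)] by (simp add: H_def scaleR_conv_of_real)
    moreover have "(1 - s) * c x + s > 0"
      using col[OF that(1)] that(2)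
      by (cases "s = 0") (auto intro!: add_nonneg_pos)
    ultimately have "y $ j = 0" by (auto simp del: of_real_add of_real_mult)
    with y show "y = 0" by (metis vec_eq_iff zero_index)
  qed
  have "homotopic_with_canon (\<lambda>_. True) S GL M (\<lambda>x. H (1, x))"
    by (rule homotopic_withI[where h = "curry H"]) (use cH inv in \<open>auto simp: GL_def H_def vec_eq_iff\<close>)
  moreover have "trivial_outside (J - {j}) (H (1, x))" if "x \<in> S" for x
    using M(3)[OF that] Mj[OF that] by (auto simp: H_def trivial_outside_def mat_def)
  ultimately show thesis using that by simp
qed

text \<open>The dimension count: the real multiples of \<open>p (\<phi> (s, t))\<close> have three
  real parameters, while \<open>i\<close> and \<open>j\<close> alone provide four real coordinates.
  The condition on \<open>w $ i\<close> serves to keep \<open>w\<close> off the real line through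
  \<open>axis j 1\<close>.\<close>

lemma generic_direction:
  fixes p :: "'a::euclidean_space \<Rightarrow> complex ^ 'n" and \<phi> :: "real \<times> real \<Rightarrow> 'a"
  assumes p: "polynomial_function p" and \<phi>: "\<phi> differentiable_on UNIV"
    and "i \<in> J" "j \<in> J" "i \<noteq> j"
  obtains w where "supported J w" "w $ i \<noteq> 0"
    "\<And>x a b. x \<in> range \<phi> \<Longrightarrow> a *\<^sub>R p x + b *\<^sub>R w = 0 \<Longrightarrow> b = 0"
proof -
  \<comment> \<open>Negligibility of images is available for maps between spaces of equal dimension.
    The scalar factor and the two surface parameters are therefore stored in
    \<open>Re (z $ i)\<close>, \<open>Im (z $ i)\<close> and \<open>Re (z $ j)\<close>. The
    coordinates outside \<open>J\<close> are added freely, so a vector can be missed only on account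
    of its part in \<open>J\<close>.\<close>
  define f :: "complex ^ 'n \<Rightarrow> complex ^ 'n" where
    "f z = Re (z $ i) *\<^sub>R p (\<phi> (Im (z $ i), Re (z $ j))) + (\<chi> k. if k \<in> J then 0 else z $ k)" for z
  \<comment> \<open>The condition says \<open>Im (z $ j) = 0\<close>. As \<open>f\<close> ignores
    this coordinate, the hyperplane still contains all values of the parameters.\<close>
  define N where "N = {z :: complex ^ 'n. axis j \<i> \<bullet> z = 0}"
  have lin: "(\<lambda>z. Re (z $ k)) differentiable_on UNIV" "(\<lambda>z. Im (z $ k)) differentiable_on UNIV"
    for k :: 'n
    by (auto intro!: linear_imp_differentiable_on linearI)
  have "(\<lambda>z :: complex ^ 'n. \<phi> (Im (z $ i), Re (z $ j))) differentiable_on UNIV"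
    by (rule differentiable_on_compose[OF _ differentiable_on_subset[OF \<phi>], unfolded o_def])
      (auto intro!: linear_imp_differentiable_on linearI)
  then have "(\<lambda>z. p (\<phi> (Im (z $ i), Re (z $ j)))) differentiable_on UNIV"
    by (rule differentiable_on_compose[unfolded o_def])
      (rule differentiable_on_polynomial_function[OF p])
  then have "f differentiable_on UNIV"
    unfolding f_def
    by (intro differentiable_on_add differentiable_on_scaleR lin)
      (auto intro!: linear_imp_differentiable_on linearI simp: vec_eq_iff)
  moreover have "negligible N"
    unfolding N_def by (rule negligible_hyperplane) (simp add: axis_eq_0_iff)
  ultimately have "negligible (f ` N)"
    by (intro negligible_differentiable_image_negligible) (auto intro: differentiable_on_subset)
  moreover have "negligible {z :: complex ^ 'n. axis i 1 \<bullet> z = 0}"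
    by (rule negligible_hyperplane) (simp add: axis_eq_0_iff)
  ultimately have "negligible (f ` N \<union> {z. axis i 1 \<bullet> z = 0})"
    by (rule negligible_Un)
  then obtain w0 where w0: "w0 \<notin> f ` N" "axis i 1 \<bullet> w0 \<noteq> 0"
    by (metis (mono_tags, lifting) UNIV_eq_I UnCI mem_Collect_eq non_negligible_UNIV)
  define w where "w = (\<chi> k. if k \<in> J then w0 $ k else 0)"
  show thesis
  proof
    show "supported J w" by (simp add: w_def supported_def)
    show "w $ i \<noteq> 0" using w0(2) \<open>i \<in> J\<close> by (auto simp: w_def inner_axis')
  next
    fix x a b assume x: "x \<in> range \<phi>" and ab: "a *\<^sub>R p x + b *\<^sub>R w = 0"
    obtain s t where st: "x = \<phi> (s, t)" using x by auto
    show "b = 0"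
    proof (rule ccontr)
      assume "b \<noteq> 0"
      have w_eq: "w = (- a / b) *\<^sub>R p x"
      proof -
        have "b *\<^sub>R w = b *\<^sub>R ((- a / b) *\<^sub>R p x)"
          using ab \<open>b \<noteq> 0\<close> by (simp add: add_eq_0_iff)
        then show ?thesis using \<open>b \<noteq> 0\<close> by (simp only: scaleR_cancel_left) simp
      qed
      \<comment> \<open>The point of \<open>N\<close> at which \<open>f\<close> would take the value
        \<open>w0\<close>: scalar factor \<open>- a / b\<close>, surface parameters \<open>s\<close>
        and \<open>t\<close>.\<close>
      define z where "z = (\<chi> k. if k = i then Complex (- a / b) s else if k = j then of_real t
        else if k \<in> J then 0 else w0 $ k)"
      have z: "(\<chi> k. if k \<in> J then 0 else z $ k) = (\<chi> k. if k \<in> J then 0 else w0 $ k)"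
        "z $ i = Complex (- a / b) s" "z $ j = of_real t"
        using \<open>i \<in> J\<close> \<open>j \<in> J\<close> \<open>i \<noteq> j\<close> by (auto simp: z_def vec_eq_iff)
      have "f z = w + (\<chi> k. if k \<in> J then 0 else w0 $ k)"
        unfolding f_def z w_eq st by simp
      also have "\<dots> = w0"
        by (simp add: w_def vec_eq_iff)
      finally have "f z = w0" .
      moreover have "z \<in> N"
        using \<open>i \<noteq> j\<close> by (simp add: N_def z_def inner_axis' inner_complex_def)
      ultimately show False using w0(1) by blast
    qed
  qed
qed

lemma homotopic_GL_props:
  assumes "homotopic_with_canon (\<lambda>_. True) S GL M M'"
  shows "continuous_on S M'" "M' \<in> S \<rightarrow> GL"
  using homotopic_with_imp_continuous[OF assms] homotopic_with_imp_funspace2[OF assms] by auto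

text \<open>Three rotations, none of which meets an opposite direction: to a polynomial
  approximation \<open>p\<close>, which is too close; to the constant \<open>w\<close>, which is no
  real multiple of any \<open>p x\<close>; to \<open>axis j 1\<close>, from which \<open>w\<close>
  differs in entry \<open>i\<close>. The detour over \<open>w\<close> is made because
  \<open>p\<close> may itself be opposite to \<open>axis j 1\<close> somewhere.\<close>

lemma remove_column:
  fixes M :: "'a::euclidean_space \<Rightarrow> complex ^ 'n ^ 'n" and \<phi> :: "real \<times> real \<Rightarrow> 'a"
  assumes S: "compact S" "S = range \<phi>" "\<phi> differentiable_on UNIV"
    and M: "continuous_on S M" "M \<in> S \<rightarrow> GL" "\<And>x. x \<in> S \<Longrightarrow> trivial_outside J (M x)"
    and ij: "i \<in> J" "j \<in> J" "i \<noteq> j"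
  obtains M' where "homotopic_with_canon (\<lambda>_. True) S GL M M'"
    "\<And>x. x \<in> S \<Longrightarrow> trivial_outside (J - {j}) (M' x)"
proof -
  define v where "v x = column j (M x)" for x
  have cv: "continuous_on S v"
    unfolding v_def column_def by (intro continuous_intros M)
  have v0: "v x \<noteq> 0" if "x \<in> S" for x
  proof
    assume "v x = 0"
    then have "M x *v axis j 1 = 0"
      by (simp add: v_def column_def matrix_vector_mult_def vec_eq_iff axis_def
          if_distrib[of "\<lambda>c. _ * c"] cong: if_cong)
    then have "axis j 1 = (0 :: complex ^ 'n)"
      using M(2) that unfolding GL_def invertible_iff_trivial_kernel by blast
    then show False by (simp add: axis_eq_0_iff)
  qed
  \<comment> \<open>The smallest length of the column, positive by invertibility, is the accuracy
    demanded of the approximation.\<close>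
  obtain x0 where x0: "x0 \<in> S" "\<And>x. x \<in> S \<Longrightarrow> norm (v x0) \<le> norm (v x)"
    using continuous_attains_inf[OF S(1) _ continuous_on_norm[OF cv]] S(2) by blast
  \<comment> \<open>Approximation within this subspace keeps \<open>p\<close> supported in
    \<open>J\<close>, so that the rotations respect \<open>trivial_outside J\<close>.\<close>
  have "subspace {u :: complex ^ 'n. supported J u}"
    by (auto simp: subspace_def supported_def)
  moreover have "v ` S \<subseteq> {u. supported J u}"
    using trivial_outside_column[OF M(3) ij(2)] by (auto simp: v_def)
  ultimately obtain p where p: "polynomial_function p" "p ` S \<subseteq> {u. supported J u}"
    and vp: "\<And>x. x \<in> S \<Longrightarrow> norm (v x - p x) < norm (v x0)"
    using Stone_Weierstrass_polynomial_function_subspace[OF S(1) cv, of "norm (v x0)"] v0[OF x0(1)]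
    by (metis zero_less_norm_iff)
  \<comment> \<open>Comparing norms in \<open>(a + b) v = b (v - p)\<close>: since
    \<open>v - p\<close> is shorter than \<open>v\<close>, a positive \<open>b\<close> is
    impossible.\<close>
  have close: "a = 0 \<and> b = 0" if "x \<in> S" "0 \<le> a" "0 \<le> b" "a *\<^sub>R v x + b *\<^sub>R p x = 0" for x a b
  proof -
    have "(a + b) *\<^sub>R v x = b *\<^sub>R (v x - p x)"
      using that(4) by (simp add: algebra_simps add_eq_0_iff)
    then have "norm ((a + b) *\<^sub>R v x) = norm (b *\<^sub>R (v x - p x))" by (rule arg_cong)
    then have "(a + b) * norm (v x) = b * norm (v x - p x)"
      using that(2,3) by simp
    moreover have "norm (v x - p x) < norm (v x)"
      using vp[OF that(1)] x0(2)[OF that(1)] by linarith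
    ultimately have "b = 0"
      using that(2,3)
      by (smt (verit, best) mult_right_mono mult_strict_left_mono norm_ge_zero)
    then show ?thesis using that(4) v0[OF that(1)] by simp
  qed
  have p0: "p x \<noteq> 0" if "x \<in> S" for x
    using close[OF that, of 0 1] by auto
  obtain M1 c1 where M1: "homotopic_with_canon (\<lambda>_. True) S GL M M1"
    "\<And>x. x \<in> S \<Longrightarrow> trivial_outside J (M1 x)"
    "\<And>x. x \<in> S \<Longrightarrow> c1 x > 0 \<and> column j (M1 x) = c1 x *\<^sub>R p x"
    using rotate_column[OF M ij(2), of p] close p
    by (auto simp: v_def image_subset_iff continuous_on_polymonial_function)
  obtain w where w: "supported J w" "w $ i \<noteq> 0"
    "\<And>x a b. x \<in> S \<Longrightarrow> a *\<^sub>R p x + b *\<^sub>R w = 0 \<Longrightarrow> b = 0"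
    using generic_direction[OF p(1) S(3) ij] S(2) by metis
  have "a = 0 \<and> b = 0" if "x \<in> S" "a *\<^sub>R column j (M1 x) + b *\<^sub>R w = 0" for x a b
  proof -
    have "(a * c1 x) *\<^sub>R p x + b *\<^sub>R w = 0"
      using that M1(3)[OF that(1)] by simp
    then show ?thesis
      using w(3)[OF that(1), of "a * c1 x" b] M1(3)[OF that(1)] p0[OF that(1)] by auto
  qed
  then have opp: "a = 0 \<and> b = 0" if "x \<in> S" "0 \<le> a" "0 \<le> b"
    "a *\<^sub>R column j (M1 x) + b *\<^sub>R w = 0" for x a b
    using that by blast
  obtain M2 c2 where M2: "homotopic_with_canon (\<lambda>_. True) S GL M1 M2"
    "\<And>x. x \<in> S \<Longrightarrow> trivial_outside J (M2 x)"
    "\<And>x. x \<in> S \<Longrightarrow> c2 x > 0 \<and> column j (M2 x) = c2 x *\<^sub>R w"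
  proof (rule rotate_column[where M = M1 and S = S and J = J and j = j and u = "\<lambda>_. w"])
    show "continuous_on S M1" "M1 \<in> S \<rightarrow> GL" using homotopic_GL_props[OF M1(1)] by auto
  qed (use M1(2) ij(2) w(1) opp that in auto)
  have "a = 0 \<and> b = 0" if "x \<in> S" "a *\<^sub>R column j (M2 x) + b *\<^sub>R axis j 1 = 0" for x a b
  proof -
    have eq: "(a * c2 x) *\<^sub>R w + b *\<^sub>R axis j 1 = 0"
      using that M2(3)[OF that(1)] by simp
    then have "((a * c2 x) *\<^sub>R w + b *\<^sub>R axis j 1) $ i = 0" by simp
    then have "a = 0"
      using w(2) ij(3) M2(3)[OF that(1)] by (simp add: axis_def split: if_splits)
    then show ?thesis using eq by (simp add: axis_eq_0_iff)
  qed
  then have opp': "a = 0 \<and> b = 0" if "x \<in> S" "0 \<le> a" "0 \<le> b"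
    "a *\<^sub>R column j (M2 x) + b *\<^sub>R axis j 1 = 0" for x a b
    using that by blast
  have axis: "supported J (axis j 1 :: complex ^ 'n)"
    using ij(2) by (auto simp: supported_def axis_def)
  obtain M3 c3 where M3: "homotopic_with_canon (\<lambda>_. True) S GL M2 M3"
    "\<And>x. x \<in> S \<Longrightarrow> trivial_outside J (M3 x)"
    "\<And>x. x \<in> S \<Longrightarrow> c3 x > 0 \<and> column j (M3 x) = c3 x *\<^sub>R axis j 1"
  proof (rule rotate_column[where M = M2 and S = S and J = J and j = j and u = "\<lambda>_. axis j 1"])
    show "continuous_on S M2" "M2 \<in> S \<rightarrow> GL" using homotopic_GL_props[OF M2(1)] by auto
  qed (use M2(2) ij(2) axis opp' that in auto)
  obtain M4 where M4: "homotopic_with_canon (\<lambda>_. True) S GL M3 M4"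
    "\<And>x. x \<in> S \<Longrightarrow> trivial_outside (J - {j}) (M4 x)"
    using clear_column[OF homotopic_GL_props[OF M3(1)] M3(2) ij(2) M3(3)] by blast
  show thesis
    by (rule that[OF homotopic_with_trans[OF homotopic_with_trans[OF
          homotopic_with_trans[OF M1(1) M2(1)] M3(1)] M4(1)] M4(2)])
qed

text \<open>The index \<open>k\<close> that is kept plays the part of the second index
  \<open>i\<close> required by \<open>remove_column\<close>, so a column can be removed as long as
  \<open>J\<close> contains anything besides \<open>k\<close>.\<close>

lemma homotopic_to_one_entry:
  fixes M :: "'a::euclidean_space \<Rightarrow> complex ^ 'n ^ 'n" and \<phi> :: "real \<times> real \<Rightarrow> 'a"
  assumes S: "compact S" "S = range \<phi>" "\<phi> differentiable_on UNIV" and "k \<in> J"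
    and M: "continuous_on S M" "M \<in> S \<rightarrow> GL" "\<And>x. x \<in> S \<Longrightarrow> trivial_outside J (M x)"
  shows "\<exists>M'. homotopic_with_canon (\<lambda>_. True) S GL M M' \<and> (\<forall>x\<in>S. trivial_outside {k} (M' x))"
  using \<open>k \<in> J\<close> M
proof (induction "card J" arbitrary: J M rule: less_induct)
  case less
  show ?case
  proof (cases "J = {k}")
    case True
    then show ?thesis using less.prems by (intro exI[of _ M]) auto
  next
    case False
    then obtain j where j: "j \<in> J" "k \<noteq> j" using less.prems(1) by blast
    obtain M1 where M1: "homotopic_with_canon (\<lambda>_. True) S GL M M1"
      "\<And>x. x \<in> S \<Longrightarrow> trivial_outside (J - {j}) (M1 x)"
      using remove_column[OF S less.prems(2-4,1) j] by blast
    have "card (J - {j}) < card J" using j(1) by (intro card_Diff1_less) auto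
    with less.hyps[OF _ _ homotopic_GL_props[OF M1(1)] M1(2)] j less.prems(1)
    obtain M2 where "homotopic_with_canon (\<lambda>_. True) S GL M1 M2" "\<forall>x\<in>S. trivial_outside {k} (M2 x)"
      by blast
    then show ?thesis using M1(1) homotopic_with_trans by blast
  qed
qed

section \<open>Reduction to the determinant\<close>

definition one_entry :: "'n \<Rightarrow> complex \<Rightarrow> complex ^ 'n ^ 'n" where
  "one_entry k d = diag_mat (\<lambda>i. if i = k then d else 1)"

lemma det_one_entry: "det (one_entry k d :: complex ^ 'n ^ 'n) = d"
  by (subst det_diagonal) (auto simp: one_entry_def diag_mat_def prod.If_cases)

lemma continuous_on_one_entry: "continuous_on S (one_entry k)"
proof (rule continuous_on_matrix_entries)
  fix i j
  show "continuous_on S (\<lambda>d. one_entry k d $ i $ j)"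
    by (cases "i = j"; cases "i = k") (auto simp: one_entry_def diag_mat_def)
qed

lemma trivial_outside_singleton:
  assumes "trivial_outside {k} M"
  shows "M = one_entry k (det M)"
proof -
  have "M = one_entry k (M $ k $ k)"
    using assms by (auto simp: vec_eq_iff one_entry_def diag_mat_def trivial_outside_def mat_def)
  then show ?thesis by (metis det_one_entry)
qed

text \<open>The determinant need not be followed through the previous homotopies. The map
  \<open>one_entry k \<circ> det\<close> of \<open>GL\<close> to itself fixes the final matrices
  \<open>M'\<close>; composing the homotopy from \<open>M\<close> to \<open>M'\<close> with it leads
  back from \<open>M'\<close> to \<open>one_entry k \<circ> (det \<circ> M)\<close>.\<close>

theorem homotopic_GL_if_det:
  fixes M N :: "'a::euclidean_space \<Rightarrow> complex ^ 'n ^ 'n" and \<phi> :: "real \<times> real \<Rightarrow> 'a"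
  assumes S: "compact S" "S = range \<phi>" "\<phi> differentiable_on UNIV"
    and M: "continuous_on S M" "M \<in> S \<rightarrow> GL" and N: "continuous_on S N" "N \<in> S \<rightarrow> GL"
    and det: "homotopic_with_canon (\<lambda>_. True) S (- {0}) (det \<circ> M) (det \<circ> N)"
  shows "homotopic_with_canon (\<lambda>_. True) S GL M N"
proof -
  obtain k :: 'n where True by blast
  have reduce: "homotopic_with_canon (\<lambda>_. True) S GL M (one_entry k \<circ> (det \<circ> M))"
    if M: "continuous_on S M" "M \<in> S \<rightarrow> GL" for M :: "'a \<Rightarrow> complex ^ 'n ^ 'n"
  proof -
    obtain M' where M': "homotopic_with_canon (\<lambda>_. True) S GL M M'"
      "\<forall>x\<in>S. trivial_outside {k} (M' x)"
      using homotopic_to_one_entry[OF S UNIV_I M, of k] by (auto simp: trivial_outside_def)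
    have "homotopic_with_canon (\<lambda>_. True) S GL ((one_entry k \<circ> det) \<circ> M) ((one_entry k \<circ> det) \<circ> M')"
      by (rule homotopic_with_compose_continuous_left[OF M'(1)])
        (auto intro!: continuous_intros continuous_on_compose2[OF continuous_on_one_entry]
          simp: GL_eq_det det_one_entry)
    moreover have "homotopic_with_canon (\<lambda>_. True) S GL M' ((one_entry k \<circ> det) \<circ> M')"
      using homotopic_GL_props[OF M'(1)] M'(2)
      by (intro homotopic_with_equal) (auto simp: continuous_map_in_subtopology trivial_outside_singleton[symmetric])
    ultimately show ?thesis
      unfolding comp_assoc
      by (intro homotopic_with_trans[OF homotopic_with_trans[OF M'(1)] homotopic_with_symD])
  qed
  have "homotopic_with_canon (\<lambda>_. True) S GL (one_entry k \<circ> (det \<circ> M)) (one_entry k \<circ> (det \<circ> N))"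
    by (rule homotopic_with_compose_continuous_left[OF det])
      (auto simp: GL_eq_det det_one_entry continuous_on_one_entry)
  then show ?thesis
    by (rule homotopic_with_trans[OF homotopic_with_trans[OF reduce[OF M]]
          homotopic_with_symD[OF reduce[OF N]]])
qed

section \<open>Linear differential equations\<close>

text \<open>The square of the norm is differentiable even at zeros of \<open>f\<close>. The summand
  1 in \<open>C = 2 * B + 1\<close> absorbs the mixed term, as \<open>2 * e * norm (f s)\<close> is
  at most the sum of the two squares; then \<open>h\<close> is nonincreasing.\<close>

lemma gronwall_square:
  fixes f :: "real \<Rightarrow> 'b::real_inner"
  assumes f: "\<And>t. (f has_vector_derivative f' t) (at t)" and "B \<ge> 0"
    and le: "\<And>t. t \<in> {0..r} \<Longrightarrow> norm (f' t) \<le> B * norm (f t) + e"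
    and t: "t \<in> {0..r}"
  shows "(norm (f t))\<^sup>2 \<le> exp ((2 * B + 1) * t) * ((norm (f 0))\<^sup>2 + e\<^sup>2 * t)"
proof -
  define C where "C = 2 * B + 1"
  define h where "h s = exp (- C * s) * (f s \<bullet> f s) - e\<^sup>2 * s" for s
  define h' where "h' s = exp (- C * s) * (2 * (f s \<bullet> f' s) - C * (f s \<bullet> f s)) - e\<^sup>2" for s
  have der: "(h has_real_derivative h' s) (at s)" for s
  proof -
    have "((\<lambda>s. f s \<bullet> f s) has_real_derivative (f s \<bullet> f' s + f' s \<bullet> f s)) (at s)"
      using has_derivative_inner[OF f[unfolded has_vector_derivative_def, of s]
          f[unfolded has_vector_derivative_def, of s]]
      by (auto simp: has_field_derivative_def algebra_simps fun_eq_iff elim!: has_derivative_eq_rhs)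
    then show ?thesis
      unfolding h_def h'_def
      by (auto intro!: derivative_eq_intros simp: inner_commute algebra_simps)
  qed
  have neg: "h' s \<le> 0" if "s \<in> {0..r}" for s
  proof -
    have "f s \<bullet> f' s \<le> norm (f s) * norm (f' s)"
      by (rule norm_cauchy_schwarz)
    also have "\<dots> \<le> norm (f s) * (B * norm (f s) + e)"
      by (intro mult_left_mono le that) auto
    finally have "2 * (f s \<bullet> f' s) - C * (f s \<bullet> f s) \<le> 2 * e * norm (f s) - (norm (f s))\<^sup>2"
      by (simp add: C_def power2_norm_eq_inner algebra_simps power2_eq_square flip: power2_norm_eq_inner)
    also have "\<dots> \<le> e\<^sup>2"
      using zero_le_power2[of "norm (f s) - e"] by (simp add: power2_diff algebra_simps)
    finally have "exp (- C * s) * (2 * (f s \<bullet> f' s) - C * (f s \<bullet> f s)) \<le> exp (- C * s) * e\<^sup>2"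
      by (intro mult_left_mono) auto
    also have "\<dots> \<le> 1 * e\<^sup>2"
      using that \<open>B \<ge> 0\<close> by (intro mult_right_mono) (auto simp: C_def intro!: mult_nonpos_nonneg)
    finally show ?thesis by (simp add: h'_def)
  qed
  have "h t \<le> h 0"
    using t der neg by (intro DERIV_nonpos_imp_nonincreasing[of 0 t h]) fastforce+
  then have "exp (- C * t) * (norm (f t))\<^sup>2 \<le> (norm (f 0))\<^sup>2 + e\<^sup>2 * t"
    by (simp add: h_def power2_norm_eq_inner)
  moreover obtain E where E: "E = exp (C * t)" by blast
  moreover have "exp (- C * t) = inverse E" "E > 0"
    by (simp_all add: E exp_minus)
  ultimately have "inverse E * (norm (f t))\<^sup>2 \<le> (norm (f 0))\<^sup>2 + e\<^sup>2 * t" "E > 0"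
    by (simp_all only:)
  then have "(norm (f t))\<^sup>2 \<le> E * ((norm (f 0))\<^sup>2 + e\<^sup>2 * t)"
    by (simp add: field_simps)
  then show ?thesis
    by (simp add: E C_def)
qed

lemma gronwall_square_abs:
  fixes f :: "real \<Rightarrow> 'b::real_inner"
  assumes f: "\<And>t. (f has_vector_derivative f' t) (at t)" and "B \<ge> 0"
    and le: "\<And>t. \<bar>t\<bar> \<le> r \<Longrightarrow> norm (f' t) \<le> B * norm (f t) + e"
    and t: "\<bar>t\<bar> \<le> r"
  shows "(norm (f t))\<^sup>2 \<le> exp ((2 * B + 1) * r) * ((norm (f 0))\<^sup>2 + e\<^sup>2 * r)"
proof -
  have "(norm (f t))\<^sup>2 \<le> exp ((2 * B + 1) * \<bar>t\<bar>) * ((norm (f 0))\<^sup>2 + e\<^sup>2 * \<bar>t\<bar>)"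
  proof (cases "t \<ge> 0")
    case True
    then show ?thesis
      using gronwall_square[OF f \<open>B \<ge> 0\<close>, of r e t] le t by auto
  next
    case False
    have "(uminus has_vector_derivative -1) (at s)" for s :: real
      by (auto simp flip: has_real_derivative_iff_has_vector_derivative intro!: derivative_eq_intros)
    then have "((\<lambda>s. f (- s)) has_vector_derivative - f' (- s)) (at s)" for s
      using vector_diff_chain_at[of uminus "-1" s f "f' (- s)"] f[of "- s"]
      by (simp add: o_def)
    from gronwall_square[OF this \<open>B \<ge> 0\<close>, of r e "- t"] show ?thesis
      using le t False by auto
  qed
  also have "\<dots> \<le> exp ((2 * B + 1) * r) * ((norm (f 0))\<^sup>2 + e\<^sup>2 * r)"
    using t \<open>B \<ge> 0\<close> by (intro mult_mono add_mono mult_left_mono) (auto intro!: add_nonneg_nonneg)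
  finally show ?thesis .
qed

section \<open>Uniqueness and dependence on parameters\<close>

lemma norm_matrix_mult_le:
  obtains C where "C > 0"
    "\<And>(M :: complex ^ 'n ^ 'n) (N :: complex ^ 'n ^ 'n). norm (M ** N) \<le> C * norm M * norm N"
  using bounded_bilinear.pos_bounded[OF bounded_bilinear_matrix_mult]
  by (metis mult.assoc mult.commute)

text \<open>Gronwall with \<open>e = 0\<close> after moving \<open>t0\<close> to the origin; the
  coefficients are bounded on the compact interval that reaches \<open>t\<close>.\<close>

lemma linear_ode_zero:
  fixes f :: "real \<Rightarrow> complex ^ 'n ^ 'n"
  assumes A: "continuous_on UNIV A" and f: "\<And>t. (f has_vector_derivative A t ** f t) (at t)"
    and "f t0 = 0"
  shows "f t = 0"
proof -
  obtain C where C: "C > 0"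
    "\<And>(M :: complex ^ 'n ^ 'n) (N :: complex ^ 'n ^ 'n). norm (M ** N) \<le> C * norm M * norm N"
    by (rule norm_matrix_mult_le) blast
  define r where "r = \<bar>t - t0\<bar>"
  define g where "g s = f (t0 + s)" for s
  have "compact (A ` {t0 - r..t0 + r})"
    by (intro compact_continuous_image continuous_on_subset[OF A]) auto
  then obtain b where b: "b > 0" "\<And>s. s \<in> {t0 - r..t0 + r} \<Longrightarrow> norm (A s) \<le> b"
    using compact_imp_bounded bounded_pos by (metis imageI)
  have "((+) t0 has_vector_derivative 1) (at s)" for s
    by (auto simp flip: has_real_derivative_iff_has_vector_derivative intro!: derivative_eq_intros)
  then have g: "(g has_vector_derivative A (t0 + s) ** g s) (at s)" for s
    using vector_diff_chain_at[of "\<lambda>s. t0 + s" 1 s f "A (t0 + s) ** f (t0 + s)"] f[of "t0 + s"]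
    by (simp add: o_def g_def[abs_def])
  have "(norm (g (t - t0)))\<^sup>2 \<le> exp ((2 * (C * b) + 1) * r) * ((norm (g 0))\<^sup>2 + 0\<^sup>2 * r)"
  proof (rule gronwall_square_abs[OF g])
    show "0 \<le> C * b" using C(1) b(1) by simp
    show "\<bar>t - t0\<bar> \<le> r" by (simp add: r_def)
    show "norm (A (t0 + s) ** g s) \<le> C * b * norm (g s) + 0" if "\<bar>s\<bar> \<le> r" for s
    proof -
      have "norm (A (t0 + s) ** g s) \<le> C * norm (A (t0 + s)) * norm (g s)" by (rule C)
      also have "\<dots> \<le> C * b * norm (g s)"
        using that C(1) by (intro mult_right_mono mult_left_mono b) auto
      finally show ?thesis by simp
    qed
  qed
  then show ?thesis using \<open>f t0 = 0\<close> by (simp add: g_def)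
qed

lemma linear_ode_unique:
  fixes f g :: "real \<Rightarrow> complex ^ 'n ^ 'n"
  assumes A: "continuous_on UNIV A" and f: "\<And>t. (f has_vector_derivative A t ** f t) (at t)"
    and g: "\<And>t. (g has_vector_derivative A t ** g t) (at t)" and "f t0 = g t0"
  shows "f t = g t"
proof -
  have "((\<lambda>t. f t - g t) has_vector_derivative A t ** (f t - g t)) (at t)" for t
    using has_vector_derivative_diff[OF f g, of t]
    by (simp add: bounded_bilinear.diff_right[OF bounded_bilinear_matrix_mult])
  from linear_ode_zero[OF A this, of t0 t] show ?thesis
    using \<open>f t0 = g t0\<close> by simp
qed

lemma has_vector_derivative_matrix_mult_const:
  fixes f :: "real \<Rightarrow> complex ^ 'n ^ 'n"
  assumes "(f has_vector_derivative f') (at t)"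
  shows "((\<lambda>t. f t ** M) has_vector_derivative f' ** M) (at t)"
  by (rule bounded_linear.has_vector_derivative
      [OF bounded_bilinear.bounded_linear_left[OF bounded_bilinear_matrix_mult] assms])

lemma invertible_fundamental_solution:
  assumes A: "continuous_on UNIV A" and X: "fundamental_solution A X"
  shows "invertible (X g t)"
  unfolding invertible_iff_trivial_kernel
proof (intro allI impI)
  fix c assume c: "X g t *v c = 0"
  have cA: "continuous_on UNIV (\<lambda>t. A (g, t))"
    by (rule continuous_on_compose2[OF A]) (auto intro!: continuous_intros)
  \<comment> \<open>The vector \<open>c\<close> repeated in every column, which brings the matrix
    version of uniqueness to bear: the solution \<open>X g t ** C\<close> vanishes at one time,
    hence at 0, where it equals \<open>C\<close>.\<close>
  define C where "C = (\<chi> i (j::'a). c $ i)"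
  have der: "((\<lambda>t. X g t ** C) has_vector_derivative A (g, t) ** (X g t ** C)) (at t)" for t
    using has_vector_derivative_matrix_mult_const[of "X g" "A (g, t) ** X g t" t C] X
    by (simp add: fundamental_solution_def matrix_mul_assoc)
  have "X g t ** C = 0"
    using c by (simp add: C_def matrix_matrix_mult_def matrix_vector_mult_def vec_eq_iff)
  from linear_ode_zero[OF cA der this, of 0] have "C = 0"
    using X by (simp add: fundamental_solution_def)
  then show "c = 0" by (simp add: C_def vec_eq_iff)
qed

text \<open>The difference of the solutions for \<open>g\<close> and \<open>g0\<close> solves the
  equation for \<open>g\<close> with the forcing term
  \<open>(A (g, t) - A (g0, t)) ** X g0 t\<close>. Uniform continuity of \<open>A\<close> on a
  compact box makes that term small, and Gronwall makes the difference small uniformly for times up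
  to \<open>r\<close>.\<close>

lemma continuous_on_fundamental_solution:
  fixes A :: "real \<times> real \<Rightarrow> complex ^ 'n ^ 'n"
  assumes A: "continuous_on UNIV A" and X: "fundamental_solution A X"
  shows "continuous_on UNIV (\<lambda>p. X (fst p) (snd p))"
  unfolding continuous_on_eq_continuous_at[OF open_UNIV]
proof
  fix p0 :: "real \<times> real"
  obtain g0 t0 where p0: "p0 = (g0, t0)" by fastforce
  obtain C where C: "C > 0"
    "\<And>(M :: complex ^ 'n ^ 'n) (N :: complex ^ 'n ^ 'n). norm (M ** N) \<le> C * norm M * norm N"
    by (rule norm_matrix_mult_le) blast
  define r where "r = \<bar>t0\<bar> + 1"
  have r: "r > 0" by (simp add: r_def)
  have X': "(X g has_vector_derivative A (g, t) ** X g t) (at t)" "X g 0 = mat 1" for g t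
    using X by (auto simp: fundamental_solution_def)
  have cX: "continuous_on UNIV (X g)" for g
    by (simp add: continuous_on_eq_continuous_at has_vector_derivative_continuous[OF X'(1)])
  have box: "compact ({g0 - 1..g0 + 1} \<times> {- r..r})"
    by (rule compact_Times) simp_all
  have "compact (A ` ({g0 - 1..g0 + 1} \<times> {- r..r}))"
    by (rule compact_continuous_image[OF continuous_on_subset[OF A subset_UNIV] box])
  then obtain a where a0: "a > 0" "\<And>y. y \<in> {g0 - 1..g0 + 1} \<times> {- r..r} \<Longrightarrow> norm (A y) \<le> a"
    using compact_imp_bounded bounded_pos by (metis imageI)
  then have a: "a > 0" "\<And>g t. \<bar>g - g0\<bar> \<le> 1 \<Longrightarrow> \<bar>t\<bar> \<le> r \<Longrightarrow> norm (A (g, t)) \<le> a"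
    by (auto intro!: a0(2))
  have "compact (X g0 ` {- r..r})"
    by (intro compact_continuous_image continuous_on_subset[OF cX]) auto
  then obtain m where m0: "m > 0" "\<And>t. t \<in> {- r..r} \<Longrightarrow> norm (X g0 t) \<le> m"
    using compact_imp_bounded bounded_pos by (metis imageI)
  then have m: "m > 0" "\<And>t. \<bar>t\<bar> \<le> r \<Longrightarrow> norm (X g0 t) \<le> m"
    by (auto intro!: m0(2))
  \<comment> \<open>Gronwall will bound the squared difference by \<open>Q * d\<^sup>2\<close> when
    the coefficients differ by less than \<open>d\<close>; the \<open>d\<close> chosen below makes
    this a quarter of the square of \<open>e / 2\<close>.\<close>
  define Q where "Q = exp ((2 * (C * a) + 1) * r) * ((C * m)\<^sup>2 * r)"
  have Q: "Q > 0" unfolding Q_def using C(1) m(1) r by simp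
  show "isCont (\<lambda>p. X (fst p) (snd p)) p0"
    unfolding continuous_at_eps_delta
  proof (intro allI impI)
    fix e :: real assume "e > 0"
    define d where "d = e / 2 / sqrt (4 * Q)"
    have d: "d > 0" "Q * d\<^sup>2 < (e / 2)\<^sup>2"
      using \<open>e > 0\<close> Q by (auto simp: d_def power_divide field_simps)
    have "uniformly_continuous_on ({g0 - 1..g0 + 1} \<times> {- r..r}) A"
      by (intro compact_uniformly_continuous continuous_on_subset[OF A] box) auto
    then obtain \<delta> where \<delta>: "\<delta> > 0"
      "\<And>x y. x \<in> {g0 - 1..g0 + 1} \<times> {- r..r} \<Longrightarrow> y \<in> {g0 - 1..g0 + 1} \<times> {- r..r} \<Longrightarrow>
         dist y x < \<delta> \<Longrightarrow> dist (A y) (A x) < d"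
      using d(1) unfolding uniformly_continuous_on_def by metis
    have close: "norm (X g t - X g0 t) < e / 2" if g: "\<bar>g - g0\<bar> < min 1 \<delta>" and t: "\<bar>t\<bar> \<le> r" for g t
    proof -
      define D' where "D' t = A (g, t) ** X g t - A (g0, t) ** X g0 t" for t
      have D': "D' t = A (g, t) ** (X g t - X g0 t) + (A (g, t) - A (g0, t)) ** X g0 t" for t
        by (simp add: D'_def bounded_bilinear.diff_right[OF bounded_bilinear_matrix_mult]
            bounded_bilinear.diff_left[OF bounded_bilinear_matrix_mult])
      have der: "((\<lambda>t. X g t - X g0 t) has_vector_derivative D' t) (at t)" for t
        unfolding D'_def by (intro has_vector_derivative_diff X')
      have "(norm (X g t - X g0 t))\<^sup>2
          \<le> exp ((2 * (C * a) + 1) * r) * ((norm (X g 0 - X g0 0))\<^sup>2 + (C * d * m)\<^sup>2 * r)"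
      proof (rule gronwall_square_abs[OF der _ _ t])
        show "0 \<le> C * a" using C(1) a(1) by simp
        fix s assume s: "\<bar>s\<bar> \<le> r"
        have "norm (A (g, s) ** (X g s - X g0 s)) \<le> C * norm (A (g, s)) * norm (X g s - X g0 s)"
          by (rule C)
        also have "\<dots> \<le> C * a * norm (X g s - X g0 s)"
          using C(1) g s by (intro mult_right_mono mult_left_mono a) auto
        finally have 1: "norm (A (g, s) ** (X g s - X g0 s)) \<le> C * a * norm (X g s - X g0 s)" .
        have "dist (A (g, s)) (A (g0, s)) < d"
          using g s by (intro \<delta>) (auto simp: dist_Pair_Pair dist_real_def abs_le_iff)
        then have "norm (A (g, s) - A (g0, s)) \<le> d" by (simp add: dist_norm)
        moreover have "norm ((A (g, s) - A (g0, s)) ** X g0 s)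
            \<le> C * norm (A (g, s) - A (g0, s)) * norm (X g0 s)" by (rule C)
        ultimately have 2: "norm ((A (g, s) - A (g0, s)) ** X g0 s) \<le> C * d * m"
          using C(1) d(1) m(2)[OF s] by (smt (verit) mult_mono norm_ge_zero mult_nonneg_nonneg)
        show "norm (D' s) \<le> C * a * norm (X g s - X g0 s) + C * d * m"
          unfolding D' using 1 2 norm_triangle_ineq[of "A (g, s) ** (X g s - X g0 s)"
              "(A (g, s) - A (g0, s)) ** X g0 s"] by linarith
      qed
      also have "\<dots> = Q * d\<^sup>2" by (simp add: X'(2) Q_def power_mult_distrib algebra_simps)
      also have "\<dots> < (e / 2)\<^sup>2" by (rule d)
      finally show ?thesis using \<open>e > 0\<close> by (rule_tac power2_less_imp_less) simp_all
    qed
    obtain \<delta>' where \<delta>': "\<delta>' > 0" "\<And>t. dist t t0 < \<delta>' \<Longrightarrow> dist (X g0 t) (X g0 t0) < e / 2"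
      using cX[of g0] \<open>e > 0\<close> unfolding continuous_on_iff by (metis UNIV_I half_gt_zero)
    show "\<exists>da>0. \<forall>p. dist p p0 < da \<longrightarrow> dist (X (fst p) (snd p)) (X (fst p0) (snd p0)) < e"
    proof (intro exI conjI allI impI)
      show "min (min 1 \<delta>) \<delta>' > 0" using \<delta>(1) \<delta>'(1) by simp
      fix p assume p: "dist p p0 < min (min 1 \<delta>) \<delta>'"
      have "\<bar>fst p - g0\<bar> < min 1 \<delta>" "dist (snd p) t0 < \<delta>'" "\<bar>snd p - t0\<bar> < 1"
        using p dist_fst_le[of p p0] dist_snd_le[of p p0] by (auto simp: p0 dist_real_def)
      moreover from this have "\<bar>snd p\<bar> \<le> r" by (simp add: r_def)
      ultimately have "norm (X (fst p) (snd p) - X g0 (snd p)) < e / 2"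
        "dist (X g0 (snd p)) (X g0 t0) < e / 2"
        using close \<delta>' by auto
      then show "dist (X (fst p) (snd p)) (X (fst p0) (snd p0)) < e"
        unfolding p0 using dist_triangle_half_r[of "X g0 (snd p)" "X (fst p) (snd p)" e "X g0 t0"]
        by (simp add: dist_norm norm_minus_commute)
    qed
  qed
qed

section \<open>The Lyapunov transform\<close>

lemma diag_mat_mult: "diag_mat c ** diag_mat d = diag_mat (\<lambda>n. c n * d n :: complex)"
  by (auto simp: diag_mat_def matrix_matrix_mult_def vec_eq_iff if_distrib[of "\<lambda>c. c * _"] cong: if_cong)

lemma diag_mat_one: "diag_mat (\<lambda>_. 1) = mat 1"
  by (auto simp: diag_mat_def mat_def)

lemma matrix_mult_diag_mat: "(M ** diag_mat c) $ i $ j = M $ i $ j * c j"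
  by (simp add: diag_mat_def matrix_matrix_mult_def if_distrib[of "\<lambda>c. _ * c"] cong: if_cong)

text \<open>Conjugation by \<open>V\<close> commutes with powers and, being bounded and linear, with
  the sum of the series, which converges entrywise in the diagonal case.\<close>

lemma mat_exp_diagonalized:
  fixes V :: "complex ^ 'n ^ 'n"
  assumes V: "invertible V"
  shows "mat_exp (V ** diag_mat d ** matrix_inv V) = V ** diag_mat (\<lambda>n. exp (d n)) ** matrix_inv V"
proof -
  define M where "M = V ** diag_mat d ** matrix_inv V"
  have pow: "((**) M ^^ k) (mat 1) = V ** diag_mat (\<lambda>n. d n ^ k) ** matrix_inv V" for k
  proof (induction k)
    case 0
    then show ?case by (simp add: diag_mat_one matrix_inv_mult[OF V])
  next
    case (Suc k)
    have "M ** (V ** diag_mat (\<lambda>n. d n ^ k) ** matrix_inv V)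
        = V ** diag_mat d ** (matrix_inv V ** V) ** diag_mat (\<lambda>n. d n ^ k) ** matrix_inv V"
      by (simp add: M_def matrix_mul_assoc)
    also have "\<dots> = V ** (diag_mat d ** diag_mat (\<lambda>n. d n ^ k)) ** matrix_inv V"
      by (simp add: matrix_inv_mult[OF V] matrix_mul_assoc)
    finally show ?case using Suc by (simp add: diag_mat_mult)
  qed
  have "(\<lambda>k. (1 / fact k) *\<^sub>R diag_mat (\<lambda>n. d n ^ k)) sums diag_mat (\<lambda>n. exp (d n))"
    unfolding sums_def
  proof (intro vec_tendstoI)
    fix i j
    have "(\<lambda>k. (1 / fact k) *\<^sub>R (diag_mat (\<lambda>n. d n ^ k) $ i $ j)) sums (diag_mat (\<lambda>n. exp (d n)) $ i $ j)"
      using exp_converges[of "d i"] by (cases "i = j") (auto simp: diag_mat_def divide_inverse)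
    then show "(\<lambda>m. (\<Sum>k<m. (1 / fact k) *\<^sub>R diag_mat (\<lambda>n. d n ^ k)) $ i $ j)
        \<longlonglongrightarrow> diag_mat (\<lambda>n. exp (d n)) $ i $ j"
      by (simp add: sums_def)
  qed
  from bounded_linear.sums[OF bounded_bilinear.bounded_linear_left[OF bounded_bilinear_matrix_mult]
      bounded_linear.sums[OF bounded_bilinear.bounded_linear_right[OF bounded_bilinear_matrix_mult] this]]
  have "(\<lambda>k. (1 / fact k) *\<^sub>R (V ** diag_mat (\<lambda>n. d n ^ k) ** matrix_inv V))
      sums (V ** diag_mat (\<lambda>n. exp (d n)) ** matrix_inv V)"
    by (simp add: bounded_bilinear.scaleR_left[OF bounded_bilinear_matrix_mult]
        bounded_bilinear.scaleR_right[OF bounded_bilinear_matrix_mult])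
  then show ?thesis
    unfolding mat_exp_def M_def[symmetric] pow by (rule sums_unique[symmetric])
qed

section \<open>Eigenlines and matrices of eigenvectors\<close>

lemma CP_span:
  assumes "l \<in> CP" "v \<in> l" "v \<noteq> 0"
  shows "l = vec.span {v}"
proof
  have "vec.independent {v}" using \<open>v \<noteq> 0\<close> by simp
  then show "l \<subseteq> vec.span {v}"
    using assms by (intro vec.card_ge_dim_independent) (auto simp: CP_def)
  show "vec.span {v} \<subseteq> l"
    using assms by (intro vec.span_minimal) (auto simp: CP_def)
qed

lemma affine_chart:
  assumes "l \<in> chart_domain i"
  shows "affine_chart i l \<in> l" "affine_chart i l $ i = 1"
proof -
  obtain v where v: "l \<in> CP" "v \<in> l" "v $ i \<noteq> 0"
    using assms by (auto simp: chart_domain_def)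
  then have l: "l = vec.span {v}" by (intro CP_span) auto
  have "\<exists>!w. w \<in> l \<and> w $ i = 1"
    unfolding l vec.span_singleton
    by (rule ex1I[of _ "(1 / v $ i) *s v"]) (use v(3) in \<open>auto simp: field_simps\<close>)
  from theI'[OF this] show "affine_chart i l \<in> l" "affine_chart i l $ i = 1"
    by (auto simp: affine_chart_def)
qed

text \<open>The condition on \<open>V\<close> in the locale, detached from it so that other
  eigenvector matrices can take its place.\<close>

definition spans_lines :: "complex ^ 'n ^ 'n \<Rightarrow> ('n \<Rightarrow> (complex ^ 'n) set) \<Rightarrow> bool" where
  "spans_lines V eta \<longleftrightarrow> (\<forall>n. column n V \<in> eta n \<and> column n V \<noteq> 0)"

lemma spans_lines_invertible:
  assumes "eigenline_system M lam eta" "spans_lines V eta"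
  shows "invertible V"
proof -
  have "(\<Union>n. eta n) \<subseteq> vec.span (columns V)"
  proof
    fix v assume "v \<in> (\<Union>n. eta n)"
    then obtain n where "v \<in> eta n" by blast
    then have "v \<in> vec.span {column n V}"
      using CP_span[of "eta n" "column n V"] assms by (auto simp: eigenline_system_def spans_lines_def)
    also have "\<dots> \<subseteq> vec.span (columns V)"
      by (rule vec.span_mono) (auto simp: columns_def)
    finally show "v \<in> vec.span (columns V)" .
  qed
  then have "vec.span (\<Union>n. eta n) \<subseteq> vec.span (columns V)"
    by (intro vec.span_minimal) auto
  then have "vec.span (columns V) = UNIV"
    using assms(1) by (auto simp: eigenline_system_def)
  then show ?thesis
    by (simp add: invertible_right_inverse matrix_right_invertible_span_columns)
qed

lemma spans_lines_eigen:
  assumes "eigenline_system M lam eta" "spans_lines V eta"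
  shows "M ** V = V ** diag_mat lam"
proof -
  have "M *v column n V = lam n *s column n V" for n
    using assms by (simp add: eigenline_system_def spans_lines_def)
  then have "(M *v column j V) $ i = (lam j *s column j V) $ i" for i j
    by simp
  then show ?thesis
    by (simp add: vec_eq_iff matrix_mult_diag_mat)
      (simp add: matrix_matrix_mult_def matrix_vector_mult_def column_def mult.commute)
qed

text \<open>Two such matrices differ by a diagonal factor on the right, which commutes with
  \<open>diag_mat d\<close>. The entries of \<open>d\<close> are arbitrary: exponents may differ
  even where multipliers coincide, so the lines matter and not just the eigenspaces.\<close>

lemma conjugate_diag_mat_cong:
  assumes "eigenline_system M lam eta" "spans_lines V eta" "spans_lines V' eta"
  shows "V ** diag_mat d ** matrix_inv V = V' ** diag_mat d ** matrix_inv V'"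
proof -
  have "\<exists>c. column n V' = c *s column n V" for n
  proof -
    have "column n V' \<in> vec.span {column n V}"
      using CP_span[of "eta n" "column n V"] assms by (auto simp: eigenline_system_def spans_lines_def)
    then show ?thesis by (auto simp: vec.span_singleton)
  qed
  then obtain c where "\<And>n. column n V' = c n *s column n V" by metis
  then have V': "V' = V ** diag_mat c"
    by (simp add: vec_eq_iff matrix_mult_diag_mat column_def mult.commute)
  note inv = matrix_inv_mult[OF spans_lines_invertible[OF assms(1,2)]]
    matrix_inv_mult[OF spans_lines_invertible[OF assms(1,3)]]
  have "V ** diag_mat d ** matrix_inv V = V ** diag_mat d ** matrix_inv V ** (V' ** matrix_inv V')"
    by (simp add: inv)
  also have "\<dots> = V ** diag_mat d ** (matrix_inv V ** V) ** diag_mat c ** matrix_inv V'"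
    unfolding V' by (simp only: matrix_mul_assoc)
  also have "\<dots> = V ** (diag_mat d ** diag_mat c) ** matrix_inv V'"
    by (simp add: inv matrix_mul_assoc)
  also have "\<dots> = V ** (diag_mat c ** diag_mat d) ** matrix_inv V'"
    by (simp add: diag_mat_mult mult.commute)
  finally show ?thesis by (simp add: V' matrix_mul_assoc)
qed

lemma continuous_on_diag_mat [continuous_intros]:
  fixes f :: "'n::finite \<Rightarrow> 'a::topological_space \<Rightarrow> complex"
  assumes "\<And>n. continuous_on S (f n)"
  shows "continuous_on S (\<lambda>x. diag_mat (\<lambda>n. f n x))"
proof (rule continuous_on_matrix_entries)
  fix i j
  show "continuous_on S (\<lambda>x. diag_mat (\<lambda>n. f n x) $ i $ j)"
    using assms by (cases "i = j") (auto simp: diag_mat_def)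
qed

lemma C1_imp_continuous_on: "f C1_differentiable_on S \<Longrightarrow> continuous_on S f"
  by (meson C1_differentiable_imp_piecewise piecewise_C1_differentiable_on_def)

text \<open>The affine charts supply normalized eigenvectors depending continuously on the
  parameter; finitely many neighborhoods are intersected.\<close>

lemma local_eigenvector_matrix:
  assumes "\<And>n. C1_into_CP (eta n) UNIV"
  obtains U W where "open U" "(x::real) \<in> U" "continuous_on U W"
    "\<And>y. y \<in> U \<Longrightarrow> spans_lines (W y) (\<lambda>n. eta n y)"
proof -
  have "\<exists>i U. open U \<and> x \<in> U \<and> eta n ` U \<subseteq> chart_domain i \<and>
      (\<lambda>y. affine_chart i (eta n y)) C1_differentiable_on U" for n
    using assms[of n] unfolding C1_into_CP_def by blast
  then obtain i U where U: "\<And>n. open (U n)" "\<And>n. x \<in> U n" "\<And>n. eta n ` U n \<subseteq> chart_domain (i n)"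
    "\<And>n. (\<lambda>y. affine_chart (i n) (eta n y)) C1_differentiable_on U n"
    by metis
  define W where "W y = (\<chi> k n. affine_chart (i n) (eta n y) $ k)" for y
  have W: "column n (W y) = affine_chart (i n) (eta n y)" for n y
    by (simp add: W_def column_def vec_eq_iff)
  show thesis
  proof
    show "open (\<Inter>n. U n)" "x \<in> (\<Inter>n. U n)" using U(1,2) by (auto intro: open_INT)
    show "continuous_on (\<Inter>n. U n) W"
      unfolding W_def
      by (intro continuous_on_vec_lambda continuous_on_component
          continuous_on_subset[OF C1_imp_continuous_on[OF U(4)]]) auto
    show "spans_lines (W y) (\<lambda>n. eta n y)" if "y \<in> (\<Inter>n. U n)" for y
      unfolding spans_lines_def W
    proof
      fix n
      have "eta n y \<in> chart_domain (i n)" using U(3) that by blast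
      from affine_chart[OF this]
      show "affine_chart (i n) (eta n y) \<in> eta n y \<and> affine_chart (i n) (eta n y) \<noteq> 0" by auto
    qed
  qed
qed

section \<open>The transform as a function on the plane\<close>

context floquet_data
begin

abbreviation "P \<equiv> lyapunov_transform X mu V"

lemma eigenlines: "eigenline_system (X g T) (\<lambda>n. lam n g) (\<lambda>n. eta n g)"
  using diagonalization by (simp add: C1_diagonalization_def)

lemma V_spans: "spans_lines (V g) (\<lambda>n. eta n g)"
  using eigenvectors by (simp add: spans_lines_def)

text \<open>The freedom in \<open>W\<close> is the point: a locally continuous \<open>W\<close>
  yields continuity of \<open>P\<close>, and the matrix \<open>V\<close> at a shifted parameter
  yields periodicity.\<close>

lemma P_eq:
  assumes "spans_lines W (\<lambda>n. eta n g)"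
  shows "P g t = X g t ** (W ** diag_mat (\<lambda>n. exp (- of_real t * mu n g)) ** matrix_inv W)"
proof -
  have "- t *\<^sub>R floquet_exponent_matrix mu V g
      = V g ** diag_mat (\<lambda>n. - of_real t * mu n g) ** matrix_inv (V g)"
  proof -
    have "- t *\<^sub>R diag_mat (\<lambda>n. mu n g) = diag_mat (\<lambda>n. - of_real t * mu n g)"
      by (auto simp: diag_mat_def vec_eq_iff scaleR_conv_of_real[where 'a = complex])
    moreover have "- t *\<^sub>R (V g ** M ** N) = V g ** (- t *\<^sub>R M) ** N" for M N :: "complex ^ 'n ^ 'n"
      by (simp only: bounded_bilinear.scaleR_left[OF bounded_bilinear_matrix_mult]
          bounded_bilinear.scaleR_right[OF bounded_bilinear_matrix_mult])
    ultimately show ?thesis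
      by (simp only: floquet_exponent_matrix_def)
  qed
  then show ?thesis
    using mat_exp_diagonalized[OF spans_lines_invertible[OF eigenlines assms]]
      conjugate_diag_mat_cong[OF eigenlines V_spans assms]
    by (simp add: lyapunov_transform_def)
qed

lemma continuous_A: "continuous_on UNIV A"
  using C1_coefficients has_derivative_continuous
  unfolding C1_matrix_field_def continuous_on_eq_continuous_at[OF open_UNIV] by blast

lemma continuous_A_time: "continuous_on UNIV (\<lambda>t. A (g, t))"
  by (rule continuous_on_compose2[OF continuous_A]) (auto intro!: continuous_intros)

lemma X_solution: "(X g has_vector_derivative A (g, t) ** X g t) (at t)" "X g 0 = mat 1"
  using solution by (auto simp: fundamental_solution_def)

lemma P_in_GL: "P g t \<in> GL"
proof -
  have "invertible (V g)" by (rule spans_lines_invertible[OF eigenlines V_spans])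
  moreover from this have "invertible (matrix_inv (V g))"
    using matrix_inv_mult invertible_def by metis
  moreover have "invertible (diag_mat (\<lambda>n. exp (- of_real t * mu n g)))"
    by (simp add: invertible_det_nz det_diagonal diag_mat_def)
  ultimately show ?thesis
    unfolding P_eq[OF V_spans] GL_def
    by (simp add: invertible_mult invertible_fundamental_solution[OF continuous_A solution])
qed

lemma P_zero: "P g 0 = mat 1"
  unfolding P_eq[OF V_spans]
  by (simp add: X_solution diag_mat_one matrix_inv_mult[OF spans_lines_invertible[OF eigenlines V_spans]])

lemma continuous_P: "continuous_on UNIV (\<lambda>p. P (fst p) (snd p))"
  unfolding continuous_on_eq_continuous_at[OF open_UNIV]
proof
  fix p :: "real \<times> real"
  have "\<And>n. C1_into_CP (eta n) UNIV" using diagonalization by (simp add: C1_diagonalization_def)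
  then obtain U W where U: "open U" "fst p \<in> U" "continuous_on U W"
    "\<And>y. y \<in> U \<Longrightarrow> spans_lines (W y) (\<lambda>n. eta n y)"
    using local_eigenvector_matrix[of eta "fst p"] by metis
  have mu: "continuous_on (U \<times> UNIV) (\<lambda>p. mu n (fst p))" for n
    by (rule continuous_on_compose2[OF C1_imp_continuous_on[OF C1_exponents]]) (auto intro!: continuous_intros)
  have W: "continuous_on (U \<times> UNIV) (\<lambda>p. W (fst p))"
    by (rule continuous_on_compose2[OF U(3)]) (auto intro!: continuous_intros)
  have X: "continuous_on (U \<times> UNIV) (\<lambda>p. X (fst p) (snd p))"
    by (rule continuous_on_subset[OF continuous_on_fundamental_solution[OF continuous_A solution]]) auto
  have "continuous_on (U \<times> UNIV) (\<lambda>p. X (fst p) (snd p) **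
      (W (fst p) ** diag_mat (\<lambda>n. exp (- of_real (snd p) * mu n (fst p))) ** matrix_inv (W (fst p))))"
    using spans_lines_invertible[OF eigenlines U(4)]
    by (intro continuous_intros mu W X) auto
  then have "continuous_on (U \<times> UNIV) (\<lambda>p. P (fst p) (snd p))"
    by (rule continuous_on_eq) (use P_eq[OF U(4)] in auto)
  moreover have "open (U \<times> (UNIV :: real set))" "p \<in> U \<times> UNIV"
    using U(1,2) by (auto intro: open_Times simp: mem_Times_iff)
  ultimately show "isCont (\<lambda>p. P (fst p) (snd p)) p"
    using continuous_on_eq_continuous_at by blast
qed

text \<open>The Floquet argument: by uniqueness \<open>X g (t + T) = X g t ** X g T\<close>, and the
  monodromy matrix acts on the columns of \<open>V g\<close> by the multipliers
  \<open>exp (of_real T * mu n g)\<close>, which the extra factor in \<open>E (t + T)\<close>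
  cancels.\<close>

lemma P_periodic_time: "P g (t + T) = P g t"
proof -
  note inv = matrix_inv_mult[OF spans_lines_invertible[OF eigenlines V_spans[of g]]]
  define E where "E s = diag_mat (\<lambda>n. exp (- of_real s * mu n g))" for s :: real
  have der: "((\<lambda>t. X g (t + T)) has_vector_derivative A (g, t) ** X g (t + T)) (at t)" for t
  proof -
    have "((\<lambda>t. t + T) has_vector_derivative 1) (at t)"
      by (auto simp flip: has_real_derivative_iff_has_vector_derivative intro!: derivative_eq_intros)
    then show ?thesis
      using vector_diff_chain_at[of "\<lambda>t. t + T" 1 t "X g"] X_solution(1)[of g "t + T"] periodic_time
      by (simp add: o_def)
  qed
  have der': "((\<lambda>t. X g t ** X g T) has_vector_derivative A (g, t) ** (X g t ** X g T)) (at t)" for t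
    using has_vector_derivative_matrix_mult_const[OF X_solution(1)] by (simp add: matrix_mul_assoc)
  have X: "X g (t + T) = X g t ** X g T"
    by (rule linear_ode_unique[OF continuous_A_time der der', of 0]) (simp add: X_solution)
  have lam: "X g T ** V g = V g ** diag_mat (\<lambda>n. exp (of_real T * mu n g))"
    using spans_lines_eigen[OF eigenlines V_spans] by (simp add: exponents)
  have "X g (t + T) ** (V g ** E (t + T) ** matrix_inv (V g))
      = X g t ** (X g T ** V g) ** E (t + T) ** matrix_inv (V g)"
    by (simp add: X matrix_mul_assoc)
  also have "\<dots> = X g t ** (V g ** (diag_mat (\<lambda>n. exp (of_real T * mu n g)) ** E (t + T)) ** matrix_inv (V g))"
    unfolding lam by (simp add: matrix_mul_assoc)
  also have "diag_mat (\<lambda>n. exp (of_real T * mu n g)) ** E (t + T) = E t"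
    by (simp add: E_def diag_mat_mult algebra_simps flip: exp_add)
  finally show ?thesis
    unfolding P_eq[OF V_spans] E_def .
qed

lemma P_periodic_parameter:
  assumes "l \<in> L" and "\<And>n. mu n (g + l) = mu n g" "\<And>n. eta n (g + l) = eta n g"
  shows "P (g + l) t = P g t"
proof -
  have "A (g + l, t) = A (g, t)" for t
    using periodic_parameter assms(1) by (simp add: periodic_mod_def)
  then have "X (g + l) t = X g t"
    by (rule_tac linear_ode_unique[OF continuous_A_time[of g], of _ _ 0])
      (use X_solution[of "g + l"] X_solution[of g] in simp_all)
  \<comment> \<open>\<open>V (g + l)\<close> is also a matrix of eigenvectors at \<open>g\<close>,
    since the lines agree.\<close>
  then show ?thesis
    using P_eq[OF V_spans] P_eq[of "V (g + l)" g t] V_spans[of "g + l"] assms(2,3) by simp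
qed

end

section \<open>Periods and logarithms\<close>

text \<open>Distinct logarithms of the same number are at least \<open>2 * pi\<close> apart, so
  \<open>f\<close> has discrete range on a connected set.\<close>

lemma constant_if_exp_constant:
  fixes f :: "'a::topological_space \<Rightarrow> complex"
  assumes "connected S" "continuous_on S f" "\<And>x. x \<in> S \<Longrightarrow> exp (f x) = c"
    and "x \<in> S" "y \<in> S"
  shows "f x = f y"
proof -
  have "f constant_on S"
  proof (rule continuous_discrete_range_constant[OF assms(1,2)])
    fix x assume x: "x \<in> S"
    have "2 * pi \<le> norm (f y - f x)" if y: "y \<in> S" "f y \<noteq> f x" for y
    proof -
      have "exp (f y) = exp (f x)" using assms(3) x y(1) by simp
      then obtain n :: int where n: "f y = f x + of_real (real_of_int (2 * n) * pi) * \<i>"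
        using exp_eq by blast
      then have "n \<noteq> 0" using y(2) by auto
      then have "1 \<le> \<bar>real_of_int n\<bar>" by linarith
      moreover have "norm (f y - f x) = 2 * pi * \<bar>real_of_int n\<bar>"
        by (simp add: n norm_mult)
      ultimately show ?thesis by simp
    qed
    then show "\<exists>e>0. \<forall>y. y \<in> S \<and> f y \<noteq> f x \<longrightarrow> e \<le> norm (f y - f x)"
      by (intro exI[of _ "2 * pi"]) auto
  qed
  then show ?thesis using assms(4,5) by (auto simp: constant_on_def)
qed

lemma multiples_add: "l \<in> multiples m \<Longrightarrow> l' \<in> multiples m \<Longrightarrow> l + l' \<in> multiples m"
  by (auto simp: multiples_def simp flip: distrib_right of_int_add)

lemma multiples_uminus: "l \<in> multiples m \<Longrightarrow> - l \<in> multiples m"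
  by (auto simp: multiples_def intro!: rev_image_eqI[of "- _"])

lemma zero_in_multiples: "0 \<in> multiples m"
  by (auto simp: multiples_def intro!: image_eqI[of _ _ 0])

lemma self_in_multiples: "m \<in> multiples m"
  by (auto simp: multiples_def intro!: image_eqI[of _ _ 1])

lemma coset_add:
  assumes "l \<in> multiples m"
  shows "coset (multiples m) (x + l) = coset (multiples m) x"
proof -
  have "x + l + l' \<in> coset (multiples m) x" if "l' \<in> multiples m" for l'
    using multiples_add[OF assms that] by (auto simp: coset_def add.assoc)
  moreover have "x + l' \<in> coset (multiples m) (x + l)" if "l' \<in> multiples m" for l'
    using multiples_add[OF multiples_uminus[OF assms] that]
    by (auto simp: coset_def intro!: image_eqI[of _ _ "- l + l'"])
  ultimately show ?thesis by (auto simp: coset_def)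
qed

lemma periodic_modI:
  assumes "\<And>x. f (x + m) = f x"
  shows "periodic_mod (multiples m) f"
proof -
  have nat: "f (x + real k * m) = f x" for k x
  proof (induction k)
    case (Suc k)
    then show ?case using assms[of "x + real k * m"] by (simp add: algebra_simps)
  qed simp
  have "f (x + of_int k * m) = f x" for k x
  proof (cases "k \<ge> 0")
    case True
    then show ?thesis using nat[of x "nat k"] by simp
  next
    case False
    then show ?thesis using nat[of "x + of_int k * m" "nat (- k)"] by simp
  qed
  then show ?thesis by (auto simp: periodic_mod_def multiples_def)
qed

text \<open>
  A logarithm \<open>G\<close> of the homotopy, lifted to \<open>[0,1] \<times> \<real>\<close>, need not be periodic, but its increment
  along a period is an integral multiple of \<open>2\<pi>\<i>\<close>, hence the same at both ends of the homotopy.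
\<close>

lemma homotopic_imp_periodic_log:
  fixes f g :: "real set \<Rightarrow> complex"
  assumes h: "homotopic_with (\<lambda>_. True) (quotient_space (multiples m)) (top_of_set S) f g"
    and "0 \<notin> S"
  obtains \<psi> where "continuous_on UNIV \<psi>" "\<And>x. \<psi> (x + m) = \<psi> x"
    "\<And>x. f (coset (multiples m) x) = exp (\<psi> x) * g (coset (multiples m) x)"
proof -
  let ?q = "coset (multiples m)"
  obtain h where h: "continuous_map (prod_topology (top_of_set {0..1::real}) (quotient_space (multiples m)))
      (top_of_set S) h" "\<And>x. h (0, x) = f x" "\<And>x. h (1, x) = g x"
    using h unfolding homotopic_with_def by auto
  define H where "H p = h (fst p, ?q (snd p))" for p
  have q: "continuous_map euclidean (quotient_space (multiples m)) ?q"
    by (rule quotient_imp_continuous_map[OF quotient_map_coset])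
  have "continuous_map (prod_topology (top_of_set {0..1}) euclidean)
      (prod_topology (top_of_set {0..1}) (quotient_space (multiples m))) (\<lambda>p. (fst p, ?q (snd p)))"
    by (intro continuous_map_pairedI continuous_map_fst
        continuous_map_compose[OF continuous_map_snd q, unfolded o_def])
  from continuous_map_compose[OF this h(1)]
  have "continuous_map (prod_topology (top_of_set {0..1}) euclidean) (top_of_set S) H"
    by (simp add: o_def H_def[abs_def])
  moreover have "prod_topology (top_of_set {0..1::real}) (euclidean :: real topology)
      = top_of_set ({0..1} \<times> UNIV)"
    using prod_topology_subtopology_eu[of "{0..1::real}" "UNIV :: real set"] by simp
  ultimately have H: "continuous_on ({0..1} \<times> UNIV) H" "\<And>p. p \<in> {0..1} \<times> UNIV \<Longrightarrow> H p \<in> S"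
    by (auto simp: continuous_map_in_subtopology)
  have "convex ({0..1::real} \<times> (UNIV :: real set))"
    by (intro convex_Times) auto
  then have "contractible ({0..1::real} \<times> (UNIV :: real set))"
    by (rule convex_imp_contractible)
  moreover have "H p \<noteq> 0" if "p \<in> {0..1} \<times> UNIV" for p
    using H(2)[OF that] \<open>0 \<notin> S\<close> by metis
  ultimately obtain G where G: "continuous_on ({0..1} \<times> UNIV) G" "\<And>p. p \<in> {0..1} \<times> UNIV \<Longrightarrow> H p = exp (G p)"
    using continuous_logarithm_on_contractible[OF H(1)] by metis
  define \<psi> where "\<psi> x = G (0, x) - G (1, x)" for x
  have "continuous_on UNIV (\<lambda>x. G (0, x))" "continuous_on UNIV (\<lambda>x. G (1, x))"
    by (rule continuous_on_compose2[OF G(1)]; auto intro!: continuous_intros)+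
  then have "continuous_on UNIV \<psi>"
    unfolding \<psi>_def by (intro continuous_intros)
  moreover have "\<psi> (x + m) = \<psi> x" for x
  proof -
    have "G (0, x + m) - G (0, x) = G (1, x + m) - G (1, x)"
    proof (rule constant_if_exp_constant[of "{0..1::real}" "\<lambda>s. G (s, x + m) - G (s, x)" 1])
      show "continuous_on {0..1} (\<lambda>s. G (s, x + m) - G (s, x))"
        by (intro continuous_intros continuous_on_compose2[OF G(1)]) auto
      fix s :: real assume "s \<in> {0..1}"
      moreover from this have "H (s, x) \<noteq> 0" using H(2)[of "(s, x)"] \<open>0 \<notin> S\<close> by auto
      moreover have "H (s, x + m) = H (s, x)"
        by (simp add: H_def coset_add[OF self_in_multiples])
      ultimately show "exp (G (s, x + m) - G (s, x)) = 1"
        using G(2)[of "(s, x)"] G(2)[of "(s, x + m)"] by (simp add: exp_diff)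
    qed auto
    then show ?thesis by (simp add: \<psi>_def algebra_simps)
  qed
  moreover have "f (?q x) = exp (\<psi> x) * g (?q x)" for x
    using G(2)[of "(0, x)"] G(2)[of "(1, x)"] by (simp add: \<psi>_def exp_diff H_def h)
  ultimately show thesis by (rule that)
qed

text \<open>Null-homotopy provides a periodic \<psi> with \<open>lam = exp \<psi> * c\<close>. Then
  \<open>T * mu - \<psi>\<close> is a continuous logarithm of \<open>c\<close>, hence constant, and
  \<open>mu\<close> inherits the period of \<psi>.\<close>

lemma periodic_exponent:
  assumes "T > 0" and lam: "periodic_mod (multiples m) lam" "trivial_multiplier_class (multiples m) lam"
    and mu: "continuous_on UNIV mu" "\<And>g. exp (of_real T * mu g) = lam g"
  shows "mu (g + m) = mu g"
proof -
  obtain c where c: "homotopic_with (\<lambda>_. True) (quotient_space (multiples m)) (top_of_set (- {0}))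
      (descend lam) (\<lambda>_. c)"
    using lam(2) by (auto simp: trivial_multiplier_class_def)
  obtain \<psi> where \<psi>: "continuous_on UNIV \<psi>" "\<And>x. \<psi> (x + m) = \<psi> x"
    "\<And>x. descend lam (coset (multiples m) x) = exp (\<psi> x) * c"
    by (rule homotopic_imp_periodic_log[OF c]) auto
  have "multiples m \<noteq> {}" using zero_in_multiples by blast
  from descend_coset[OF this lam(1)] have "exp (of_real T * mu x) = exp (\<psi> x) * c" for x
    using \<psi>(3) mu(2) by simp
  then have "exp (of_real T * mu x - \<psi> x) = c" for x
    by (simp add: exp_diff)
  then have "of_real T * mu (g + m) - \<psi> (g + m) = of_real T * mu g - \<psi> g"
    by (intro constant_if_exp_constant[of UNIV "\<lambda>x. of_real T * mu x - \<psi> x" c])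
      (auto intro!: continuous_intros mu \<psi>)
  then show ?thesis using \<open>T > 0\<close> by (simp add: \<psi>(2))
qed

text \<open>Each sublattice is generated by an integral multiple \<open>a n\<close> of a generator
  of \<open>L\<close>. The intersection is generated by the least common multiple, which is nonzero
  because there are finitely many \<open>a n\<close>; the absolute value then gives a positive
  generator.\<close>

lemma Inter_multiples:
  fixes Ln :: "'n::finite \<Rightarrow> real set"
  assumes L: "is_lattice L" and Ln: "\<And>n. is_lattice (Ln n)" "\<And>n. Ln n \<subseteq> L"
  obtains k where "k > 0" "(\<Inter>n. Ln n) = multiples k"
proof -
  obtain l where l: "l \<noteq> 0" "L = multiples l" using L by (auto simp: is_lattice_def)
  have "\<exists>a::int. a \<noteq> 0 \<and> Ln n = multiples (of_int a * l)" for n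
  proof -
    obtain m where m: "m \<noteq> 0" "Ln n = multiples m" using Ln(1) by (auto simp: is_lattice_def)
    then have "m \<in> multiples l" using Ln(2)[of n] l(2) self_in_multiples by blast
    then show ?thesis using m by (auto simp: multiples_def[of l])
  qed
  then obtain a :: "'n \<Rightarrow> int" where a: "\<And>n. a n \<noteq> 0" "\<And>n. Ln n = multiples (of_int (a n) * l)"
    by metis
  define b where "b = Lcm (range a)"
  have "b \<noteq> 0" unfolding b_def using a(1) by (auto simp: Lcm_0_iff)
  have mem: "x \<in> multiples (of_int c * l) \<longleftrightarrow> (\<exists>k::int. x = of_int k * l \<and> c dvd k)" for x c
  proof
    assume "x \<in> multiples (of_int c * l)"
    then obtain k :: int where "x = of_int k * (of_int c * l)" by (auto simp: multiples_def)
    then show "\<exists>k::int. x = of_int k * l \<and> c dvd k" by (intro exI[of _ "k * c"]) auto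
  next
    assume "\<exists>k::int. x = of_int k * l \<and> c dvd k"
    then show "x \<in> multiples (of_int c * l)"
      by (auto simp: multiples_def elim!: dvdE intro!: image_eqI)
  qed
  have "x \<in> (\<Inter>n. Ln n) \<longleftrightarrow> x \<in> multiples (of_int b * l)" for x
  proof
    assume "x \<in> (\<Inter>n. Ln n)"
    then have "\<forall>n. \<exists>k::int. x = of_int k * l \<and> a n dvd k" by (auto simp: a(2) mem)
    then obtain k :: "'n \<Rightarrow> int" where k: "\<And>n. x = of_int (k n) * l" "\<And>n. a n dvd k n" by metis
    obtain n0 :: 'n where True by blast
    have "k n = k n0" for n
    proof -
      have "of_int (k n) * l = of_int (k n0) * l" using k(1) by metis
      then show ?thesis using l(1) by (metis mult_right_cancel of_int_eq_iff)
    qed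
    then have "b dvd k n0" unfolding b_def using k(2) by (metis Lcm_least imageE)
    then show "x \<in> multiples (of_int b * l)" using k(1)[of n0] mem by blast
  next
    assume "x \<in> multiples (of_int b * l)"
    then obtain k :: int where k: "x = of_int k * l" "b dvd k" using mem by blast
    have "a n dvd k" for n using k(2) by (metis b_def dvd_Lcm dvd_trans rangeI)
    then show "x \<in> (\<Inter>n. Ln n)" using k(1) by (auto simp: a(2) mem)
  qed
  then have K: "(\<Inter>n. Ln n) = multiples (of_int b * l)" by blast
  have "multiples y = multiples (- y)" for y
  proof -
    have "multiples y \<subseteq> multiples (- y)" for y
      by (auto simp: multiples_def intro!: image_eqI[of _ _ "- _"])
    from this[of y] this[of "- y"] show ?thesis by auto
  qed
  then have "multiples \<bar>y\<bar> = multiples y" for y by (auto simp: abs_if)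
  with K show thesis using \<open>b \<noteq> 0\<close> l(1) by (intro that[of "\<bar>of_int b * l\<bar>"]) auto
qed

section \<open>The torus\<close>

definition circle_param :: "real \<Rightarrow> real \<Rightarrow> complex" where
  "circle_param k x = cis (2 * pi / k * x)"

text \<open>It serves twice: as the differentiable surface parameterization for the dimension count,
  and as the covering map along which doubly periodic functions descend.\<close>

definition torus_param :: "real \<Rightarrow> real \<Rightarrow> real \<times> real \<Rightarrow> complex \<times> complex" where
  "torus_param k T p = (circle_param k (fst p), circle_param T (snd p))"

abbreviation torus :: "(complex \<times> complex) set" where
  "torus \<equiv> sphere 0 1 \<times> sphere 0 1"

lemma circle_param_eq_iff:
  assumes "k > 0"
  shows "circle_param k x = circle_param k y \<longleftrightarrow> (\<exists>l\<in>multiples k. x = y + l)"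
proof -
  have "circle_param k x = circle_param k y \<longleftrightarrow> cis (2 * pi / k * x - 2 * pi / k * y) = 1"
    by (simp add: circle_param_def flip: cis_divide)
  also have "\<dots> \<longleftrightarrow> (\<exists>n::int. 2 * pi / k * x - 2 * pi / k * y = of_int n * 2 * pi)"
    unfolding cis_conv_exp exp_eq_1
    by (simp add: mult_ac)
  also have "\<dots> \<longleftrightarrow> (\<exists>n::int. x = y + of_int n * k)"
  proof (intro ex_cong1)
    fix n :: int
    have "2 * pi / k * x - 2 * pi / k * y = 2 * pi / k * (x - y)"
      by (simp add: right_diff_distrib)
    moreover have "of_int n * 2 * pi = 2 * pi / k * (of_int n * k)"
      using assms by simp
    moreover have "2 * pi / k \<noteq> 0" using assms by simp
    ultimately have "2 * pi / k * x - 2 * pi / k * y = of_int n * 2 * pi \<longleftrightarrow> x - y = of_int n * k"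
      by (metis mult_left_cancel)
    then show "2 * pi / k * x - 2 * pi / k * y = of_int n * 2 * pi \<longleftrightarrow> x = y + of_int n * k"
      by linarith
  qed
  finally show ?thesis by (auto simp: multiples_def)
qed

lemma norm_circle_param: "norm (circle_param k x) = 1"
  by (simp add: circle_param_def)

lemma continuous_on_circle_param: "continuous_on S (circle_param k)"
  unfolding circle_param_def[abs_def] by (intro continuous_intros)

lemma circle_param_image:
  assumes "k > 0"
  shows "circle_param k ` {0..k} = sphere 0 1"
proof (intro equalityI subsetI)
  fix z :: complex assume "z \<in> sphere 0 1"
  then obtain t where t: "0 \<le> t" "t < 2 * pi" "z = cis t"
    using complex_unimodular_polar[of z] by (metis cis_conv_exp cis.ctr mem_sphere_0)
  then show "z \<in> circle_param k ` {0..k}"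
    using assms by (intro image_eqI[of _ _ "t * k / (2 * pi)"]) (auto simp: circle_param_def field_simps)
qed (auto simp: circle_param_def)

text \<open>Periodicity makes the preimage picked by \<open>inv\<close> immaterial. Continuity can
  be tested on a fundamental rectangle, because a continuous map from a compact space onto a
  Hausdorff space is a quotient map.\<close>

lemma descends_to_torus:
  fixes f :: "real \<times> real \<Rightarrow> 'b::topological_space"
  assumes "k > 0" "T > 0" and f: "continuous_on UNIV f"
    and per: "\<And>x t. f (x + k, t) = f (x, t)" "\<And>x t. f (x, t + T) = f (x, t)"
  obtains F where "continuous_on torus F" "\<And>p. F (torus_param k T p) = f p"
proof -
  let ?\<phi> = "torus_param k T"
  define B where "B = {0..k} \<times> {0..T}"
  define F where "F = f \<circ> inv ?\<phi>"
  have F: "F (?\<phi> p) = f p" for p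
  proof -
    have "?\<phi> (inv ?\<phi> (?\<phi> p)) = ?\<phi> p" by (simp add: f_inv_into_f)
    then obtain l m where lm: "l \<in> multiples k" "m \<in> multiples T" "inv ?\<phi> (?\<phi> p) = (fst p + l, snd p + m)"
      using assms(1,2) by (auto simp: torus_param_def circle_param_eq_iff prod_eq_iff)
    have "periodic_mod (multiples k) (\<lambda>x. f (x, t))" "periodic_mod (multiples T) (\<lambda>t. f (x, t))" for x t
      by (intro periodic_modI per)+
    then have "f (fst p + l, snd p + m) = f (fst p, snd p)"
      using lm(1,2) by (simp add: periodic_mod_def)
    then show ?thesis by (simp add: F_def lm(3))
  qed
  have c\<phi>: "continuous_on B ?\<phi>"
    unfolding torus_param_def
    by (intro continuous_intros continuous_on_compose2[OF continuous_on_circle_param]) auto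
  have "?\<phi> ` B = circle_param k ` {0..k} \<times> circle_param T ` {0..T}"
    by (force simp: torus_param_def B_def)
  then have "?\<phi> ` B = torus"
    by (simp add: circle_param_image assms)
  then have "quotient_map (top_of_set B) (top_of_set torus) ?\<phi>"
    using c\<phi> by (intro continuous_imp_quotient_map)
      (auto simp: continuous_map_in_subtopology compact_space_subtopology B_def compact_Times
        intro!: Hausdorff_space_subtopology)
  then have "continuous_map (top_of_set torus) euclidean F"
    by (rule continuous_compose_quotient_map)
      (use F continuous_on_subset[OF f] in \<open>auto simp: o_def\<close>)
  then show thesis using that F by auto
qed

lemma torus_param_props:
  assumes "k > 0" "T > 0"
  shows "range (torus_param k T) = torus" "torus_param k T differentiable_on UNIV"
proof -
  have circle: "range (circle_param k) = sphere 0 1" if "k > 0" for k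
    using circle_param_image[OF that] by (auto simp: circle_param_def)
  have "torus_param k T ` (UNIV \<times> UNIV) = range (circle_param k) \<times> range (circle_param T)"
    by (force simp: torus_param_def simp del: UNIV_Times_UNIV)
  then show "range (torus_param k T) = torus"
    by (simp add: circle assms)
  show "torus_param k T differentiable_on UNIV"
    unfolding differentiable_on_def
  proof
    have der: "\<exists>D. (circle_param k has_derivative D) (at x)" for k x
    proof -
      define c where "c = 2 * pi / k"
      have "((\<lambda>z. exp (\<i> * of_real c * z)) has_field_derivative
          exp (\<i> * of_real c * of_real x) * (\<i> * of_real c)) (at (of_real x))"
        by (auto intro!: derivative_eq_intros)
      moreover have "circle_param k = (\<lambda>x. exp (\<i> * of_real c * of_real x))"
        by (simp add: fun_eq_iff circle_param_def cis_conv_exp mult.assoc c_def)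
      ultimately show ?thesis
        by (simp only:) (blast dest: has_vector_derivative_real_field
            has_vector_derivative_def[THEN iffD1])
    qed
    fix p :: "real \<times> real"
    obtain D1 D2 where D: "(circle_param k has_derivative D1) (at (fst p))"
      "(circle_param T has_derivative D2) (at (snd p))"
      using der by metis
    have "(torus_param k T has_derivative (\<lambda>h. (D1 (fst h), D2 (snd h)))) (at p)"
      unfolding torus_param_def[abs_def]
      by (rule has_derivative_Pair[OF
            has_derivative_compose[OF has_derivative_fst[OF has_derivative_ident] D(1)]
            has_derivative_compose[OF has_derivative_snd[OF has_derivative_ident] D(2)]])
    then show "torus_param k T differentiable at p within UNIV"
      unfolding differentiable_def by blast
  qed
qed

text \<open>Leads from the abstract quotient to the circle in the plane; homotopies found on the
  embedded torus are pulled back along it.\<close>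

definition circle_chart :: "real \<Rightarrow> real set \<Rightarrow> complex" where
  "circle_chart k = descend (circle_param k)"

lemma circle_chart_coset:
  assumes "k > 0"
  shows "circle_chart k (coset (multiples k) x) = circle_param k x"
proof -
  have "periodic_mod (multiples k) (circle_param k)"
    using assms circle_param_eq_iff by (auto simp: periodic_mod_def)
  moreover have "multiples k \<noteq> {}" using zero_in_multiples by blast
  ultimately show ?thesis by (simp add: circle_chart_def descend_coset)
qed

lemma continuous_map_circle_chart:
  assumes "k > 0"
  shows "continuous_map (quotient_space (multiples k)) (top_of_set (sphere 0 1)) (circle_chart k)"
  by (rule continuous_compose_quotient_map[OF quotient_map_coset])
    (auto simp: o_def circle_chart_coset[OF assms] continuous_map_in_subtopology
      continuous_on_circle_param norm_circle_param)

lemma continuous_map_torus_chart: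
  assumes "k > 0" "T > 0"
  shows "continuous_map (prod_topology (quotient_space (multiples k)) (quotient_space (multiples T)))
    (top_of_set torus) (map_prod (circle_chart k) (circle_chart T))"
proof -
  have "continuous_map (prod_topology (quotient_space (multiples k)) (quotient_space (multiples T)))
    (prod_topology (top_of_set (sphere 0 1)) (top_of_set (sphere 0 1)))
    (\<lambda>c. (circle_chart k (fst c), circle_chart T (snd c)))"
    using continuous_map_circle_chart[OF assms(1)] continuous_map_circle_chart[OF assms(2)]
    by (intro continuous_map_pairedI continuous_map_compose[OF continuous_map_fst, unfolded o_def]
        continuous_map_compose[OF continuous_map_snd, unfolded o_def])
  then show ?thesis
    by (simp add: prod_topology_subtopology_eu map_prod_def case_prod_unfold)
qed

section \<open>The transform as a map on the torus\<close>

context floquet_data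
begin

lemma exponent_periodic:
  assumes "T > 0" "\<And>n. trivial_multiplier_class (Ln n) (lam n)"
  shows "periodic_mod (Ln n) (mu n)"
proof -
  obtain m where m: "Ln n = multiples m"
    using multiplier_lattice[of n] by (auto simp: maximal_period_lattice_def is_lattice_def)
  have "mu n (g + m) = mu n g" for g
  proof (rule periodic_exponent[OF \<open>T > 0\<close>])
    show "periodic_mod (multiples m) (lam n)"
      using multiplier_lattice[of n] m by (simp add: maximal_period_lattice_def)
    show "trivial_multiplier_class (multiples m) (lam n)" using assms(2)[of n] m by simp
    show "continuous_on UNIV (mu n)" by (rule C1_imp_continuous_on[OF C1_exponents])
    show "exp (of_real T * mu n g) = lam n g" for g by (rule exponents)
  qed
  then show ?thesis unfolding m by (rule periodic_modI)
qed

lemma Inter_lattices: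
  obtains k where "k > 0" "(\<Inter>n. Ln n) = multiples k"
  using Inter_multiples[OF lattice, of Ln] multiplier_lattice
  by (auto simp: maximal_period_lattice_def)

text \<open>The generator \<open>k\<close> lies in every \<open>Ln n\<close>, so it is a period of
  all exponents and eigenlines, and it lies in \<open>L\<close>, so it is a period of the
  coefficients.\<close>

lemma P_on_torus:
  assumes "T > 0" "k > 0" and K: "(\<Inter>n. Ln n) = multiples k"
    and triv: "\<And>n. trivial_multiplier_class (Ln n) (lam n)"
  obtains G where "continuous_on torus G" "G \<in> torus \<rightarrow> GL"
    "\<And>x t. G (torus_param k T (x, t)) = P x t"
    "\<And>x t. descend2 P (coset (multiples k) x, coset (multiples T) t) = P x t"
proof -
  have k: "k \<in> Ln n" for n using K self_in_multiples by blast
  then have kL: "k \<in> L" using multiplier_lattice by (auto simp: maximal_period_lattice_def)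
  have Pk: "P (x + k) t = P x t" for x t
    by (rule P_periodic_parameter[OF kL])
      (use exponent_periodic[OF \<open>T > 0\<close> triv] eigenline_periodic k in \<open>auto simp: periodic_mod_def\<close>)
  obtain G where G: "continuous_on torus G" "\<And>p. G (torus_param k T p) = P (fst p) (snd p)"
    by (rule descends_to_torus[OF \<open>k > 0\<close> \<open>T > 0\<close> continuous_P]) (use Pk P_periodic_time in auto)
  have "G \<in> torus \<rightarrow> GL"
  proof
    fix y assume "y \<in> torus"
    then obtain p where "y = torus_param k T p"
      using torus_param_props(1)[OF \<open>k > 0\<close> \<open>T > 0\<close>] by blast
    then show "G y \<in> GL" using G(2) P_in_GL by simp
  qed
  moreover have "descend2 P (coset (multiples k) x, coset (multiples T) t) = P x t" for x t
  proof (rule descend2_coset)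
    show "multiples k \<noteq> {}" "multiples T \<noteq> {}" using zero_in_multiples by blast+
    show "periodic_mod (multiples k) P" "periodic_mod (multiples T) (P x)" for x
      by (rule periodic_modI, simp add: fun_eq_iff Pk P_periodic_time)+
  qed
  ultimately show thesis using that[OF G(1)] G(2) by simp
qed

end

section \<open>Homotopy of determinants\<close>

lemma homotopic_det_on_torus:
  assumes "k > 0" "T > 0"
    and G1: "continuous_on torus G1" "G1 \<in> torus \<rightarrow> - {0}"
    and G2: "continuous_on torus G2" "G2 \<in> torus \<rightarrow> - {0}"
    and axis: "\<And>x. G1 (torus_param k T (x, 0)) = (G2 (torus_param k T (x, 0)) :: complex)"
    and \<psi>: "continuous_on UNIV \<psi>" "\<And>t. \<psi> (t + T) = \<psi> t"
      "\<And>t. sgn (G1 (torus_param k T (0, t))) = exp (\<psi> t) * sgn (G2 (torus_param k T (0, t)))"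
  shows "homotopic_with_canon (\<lambda>_. True) torus (- {0}) G1 G2"
proof -
  let ?\<phi> = "torus_param k T"
  note \<phi> = torus_param_props[OF assms(1,2)]
  have c\<phi>: "continuous_on UNIV ?\<phi>"
    by (rule differentiable_imp_continuous_on[OF \<phi>(2)])
  have \<phi>_torus: "?\<phi> p \<in> torus" for p using \<phi>(1) by blast
  define d where "d p = G1 (?\<phi> p) / G2 (?\<phi> p)" for p
  have nz: "G1 (?\<phi> p) \<noteq> 0" "G2 (?\<phi> p) \<noteq> 0" for p
    using funcset_mem[OF G1(2) \<phi>_torus] funcset_mem[OF G2(2) \<phi>_torus] by auto
  have d0: "d p \<noteq> 0" for p using nz by (simp add: d_def)
  have "continuous_on UNIV (\<lambda>p. G1 (?\<phi> p))" "continuous_on UNIV (\<lambda>p. G2 (?\<phi> p))"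
    by (rule continuous_on_compose2[OF G1(1) c\<phi>] continuous_on_compose2[OF G2(1) c\<phi>];
        simp add: \<phi>(1))+
  then have cd: "continuous_on UNIV d"
    unfolding d_def using nz by (intro continuous_intros) auto
  obtain g where g: "continuous_on UNIV g" "\<And>p. d p = exp (g p)"
    using continuous_logarithm_on_contractible[OF cd convex_imp_contractible[OF convex_UNIV]] d0
    by (metis UNIV_I)
  have \<phi>_per: "?\<phi> (x + k, t) = ?\<phi> (x, t)" "?\<phi> (x, t + T) = ?\<phi> (x, t)" for x t
    using assms(1,2) self_in_multiples by (auto simp: torus_param_def circle_param_eq_iff)
  have exp_diff_g: "exp (g p - g q) = d p / d q" for p q
    by (simp add: g(2) exp_diff)
  have cg: "continuous_on S (\<lambda>x. g (f x))" if "continuous_on S f" for S f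
    by (rule continuous_on_compose2[OF g(1) that]) auto
  have g_x: "g (x + k, t) = g (x, t)" for x t
  proof -
    \<comment> \<open>The increment is a logarithm of 1, hence independent of \<open>t\<close>. On
      the axis \<open>t = 0\<close> the quotient \<open>d\<close> is 1, so \<open>g\<close> itself
      is constant there.\<close>
    have "g (x + k, t) - g (x, t) = g (x + k, 0) - g (x, 0)"
      by (rule constant_if_exp_constant[of UNIV "\<lambda>t. g (x + k, t) - g (x, t)" 1])
        (auto simp: exp_diff_g d0 d_def \<phi>_per nz intro!: continuous_intros cg)
    also have "g (x + k, 0) = g (x, 0)"
      by (rule constant_if_exp_constant[of UNIV "\<lambda>x. g (x, 0)" 1])
        (auto simp: g(2)[symmetric] d_def axis nz intro!: continuous_intros cg)
    finally show ?thesis by simp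
  qed
  have g_t: "g (x, t + T) = g (x, t)" for x t
  proof -
    \<comment> \<open>\<psi> accounts only for the argument of \<open>d\<close>, the real logarithm
      \<open>r\<close> for its modulus. Then \<open>g (0, t) - \<psi> t - r t\<close> is a logarithm
      of 1, hence constant, and both \<psi> and \<open>r\<close> have period
      \<open>T\<close>.\<close>
    define r where "r t = complex_of_real (ln (norm (d (0, t))))" for t
    have "exp (g (0, t) - \<psi> t - r t) = 1" for t
    proof -
      have "sgn (G1 (?\<phi> (0, t))) / sgn (G2 (?\<phi> (0, t))) = exp (\<psi> t)"
        using \<psi>(3)[of t] nz by (simp add: sgn_eq_0_iff)
      then have "d (0, t) = exp (\<psi> t) * of_real (norm (d (0, t)))"
        using nz by (auto simp: d_def sgn_eq norm_divide field_simps)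
      then have "exp (g (0, t)) = exp (\<psi> t) * exp (r t)"
        using d0 by (simp add: r_def g(2)[symmetric] exp_of_real)
      then show ?thesis by (simp add: exp_diff)
    qed
    moreover have "continuous_on UNIV r"
      unfolding r_def using d0
      by (intro continuous_intros continuous_on_compose2[OF cd]) auto
    ultimately have "g (0, t + T) - \<psi> (t + T) - r (t + T) = g (0, t) - \<psi> t - r t"
      by (intro constant_if_exp_constant[of UNIV "\<lambda>t. g (0, t) - \<psi> t - r t" 1])
        (auto intro!: continuous_intros cg \<psi>)
    moreover have "r (t + T) = r t" by (simp add: r_def d_def \<phi>_per)
    ultimately have "g (0, t + T) = g (0, t)" by (simp add: \<psi>(2))
    moreover have "g (x, t + T) - g (x, t) = g (0, t + T) - g (0, t)"
      by (rule constant_if_exp_constant[of UNIV "\<lambda>x. g (x, t + T) - g (x, t)" 1])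
        (auto simp: exp_diff_g d0 d_def \<phi>_per nz intro!: continuous_intros cg)
    ultimately show ?thesis by simp
  qed
  obtain \<gamma> where \<gamma>: "continuous_on torus \<gamma>" "\<And>p. \<gamma> (?\<phi> p) = g p"
    using descends_to_torus[OF assms(1,2) g(1) g_x g_t] by blast
  show ?thesis
  \<comment> \<open>\<gamma> is a logarithm of the quotient on the torus, so scaling it down to 0
    leads from \<open>G1\<close> to \<open>G2\<close> without meeting 0.\<close>
  proof (rule homotopic_withI[where h = "\<lambda>s y. exp (of_real (1 - s) * \<gamma> y) * G2 y"])
    show "continuous_on ({0..1} \<times> torus) (\<lambda>y. exp (of_real (1 - fst y) * \<gamma> (snd y)) * G2 (snd y))"
      by (intro continuous_intros continuous_on_compose2[OF \<gamma>(1)] continuous_on_compose2[OF G2(1)]) auto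
    show "exp (of_real (1 - s) * \<gamma> y) * G2 y \<in> - {0}" if "y \<in> torus" for s y
      using G2(2) that by auto
    show "exp (of_real (1 - 0) * \<gamma> y) * G2 y = G1 y" if "y \<in> torus" for y
    proof -
      have "y \<in> range ?\<phi>" using that by (simp only: \<phi>(1))
      then obtain p where y: "y = ?\<phi> p" by (rule rangeE)
      have "exp (\<gamma> y) = d p" by (simp only: y \<gamma>(2) g(2))
      then show ?thesis using nz(2)[of p] by (simp add: d_def y)
    qed
  qed simp
qed

theorem lemma6:
  fixes T :: real and K L1 L2 :: "real set"
    and A1 A2 :: "real \<times> real \<Rightarrow> complex ^ 'n ^ 'n"
    and X1 X2 :: "real \<Rightarrow> real \<Rightarrow> complex ^ 'n ^ 'n"
    and lam1 lam2 :: "'n \<Rightarrow> real \<Rightarrow> complex"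
    and eta1 eta2 :: "'n \<Rightarrow> real \<Rightarrow> (complex ^ 'n) set"
    and Ln1 Ln2 :: "'n \<Rightarrow> real set"
    and mu1 mu2 :: "'n \<Rightarrow> real \<Rightarrow> complex"
    and V1 V2 :: "real \<Rightarrow> complex ^ 'n ^ 'n"
    and P1 P2 :: "real set \<times> real set \<Rightarrow> complex ^ 'n ^ 'n"
  assumes "T > 0"
    and "floquet_data L1 T A1 X1 lam1 eta1 Ln1 mu1 V1"
    and "floquet_data L2 T A2 X2 lam2 eta2 Ln2 mu2 V2"
    and "\<And>n. trivial_multiplier_class (Ln1 n) (lam1 n)"
    and "\<And>n. trivial_multiplier_class (Ln2 n) (lam2 n)"
    and "K = (\<Inter>n. Ln1 n)"
    and "K = (\<Inter>n. Ln2 n)"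
    and "P1 = descend2 (lyapunov_transform X1 mu1 V1)"
    and "P2 = descend2 (lyapunov_transform X2 mu2 V2)"
    and "homotopic_with (\<lambda>_. True) (quotient_space (multiples T)) (top_of_set (sphere 0 1))
           (Delta \<circ> P1 \<circ> iota K) (Delta \<circ> P2 \<circ> iota K)"
  shows "homotopic_with (\<lambda>_. True)
           (prod_topology (quotient_space K) (quotient_space (multiples T))) (top_of_set GL)
           P1 P2"
proof -
  interpret F1: floquet_data L1 T A1 X1 lam1 eta1 Ln1 mu1 V1 by fact
  interpret F2: floquet_data L2 T A2 X2 lam2 eta2 Ln2 mu2 V2 by fact
  obtain k where k: "k > 0" "K = multiples k"
    using F1.Inter_lattices assms(6) by metis
  let ?\<phi> = "torus_param k T"
  let ?M1 = "lyapunov_transform X1 mu1 V1" and ?M2 = "lyapunov_transform X2 mu2 V2"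
  obtain G1 where G1: "continuous_on torus G1" "G1 \<in> torus \<rightarrow> GL"
    "\<And>x t. G1 (?\<phi> (x, t)) = ?M1 x t" "\<And>x t. P1 (coset K x, coset (multiples T) t) = ?M1 x t"
    using F1.P_on_torus[OF assms(1) k(1) _ assms(4)] assms(6,8) k(2) by metis
  obtain G2 where G2: "continuous_on torus G2" "G2 \<in> torus \<rightarrow> GL"
    "\<And>x t. G2 (?\<phi> (x, t)) = ?M2 x t" "\<And>x t. P2 (coset K x, coset (multiples T) t) = ?M2 x t"
    using F2.P_on_torus[OF assms(1) k(1) _ assms(5)] assms(7,9) k(2) by metis
  have Delta: "Delta M = sgn (det M)" for M :: "complex ^ 'n ^ 'n"
    by (simp add: Delta_def sgn_eq)
  obtain \<psi> where \<psi>: "continuous_on UNIV \<psi>" "\<And>t. \<psi> (t + T) = \<psi> t"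
    "\<And>t. (Delta \<circ> P1 \<circ> iota K) (coset (multiples T) t)
       = exp (\<psi> t) * (Delta \<circ> P2 \<circ> iota K) (coset (multiples T) t)"
    by (rule homotopic_imp_periodic_log[OF assms(10)]) auto
  have "homotopic_with_canon (\<lambda>_. True) torus (- {0}) (det \<circ> G1) (det \<circ> G2)"
  proof (rule homotopic_det_on_torus[OF k(1) assms(1) _ _ _ _ _ \<psi>(1,2)])
    show "continuous_on torus (det \<circ> G1)" "continuous_on torus (det \<circ> G2)"
      unfolding o_def by (intro continuous_intros G1 G2)+
    show "det \<circ> G1 \<in> torus \<rightarrow> - {0}" "det \<circ> G2 \<in> torus \<rightarrow> - {0}"
      using G1(2) G2(2) by (auto simp: GL_eq_det)
    show "(det \<circ> G1) (?\<phi> (x, 0)) = (det \<circ> G2) (?\<phi> (x, 0))" for x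
      by (simp add: G1(3) G2(3) F1.P_zero F2.P_zero)
    show "sgn ((det \<circ> G1) (?\<phi> (0, t))) = exp (\<psi> t) * sgn ((det \<circ> G2) (?\<phi> (0, t)))" for t
      using \<psi>(3)[of t] by (simp add: iota_def Delta G1(3,4) G2(3,4))
  qed
  then have "homotopic_with_canon (\<lambda>_. True) torus GL G1 G2"
    using torus_param_props[OF k(1) assms(1)] G1 G2
    by (intro homotopic_GL_if_det[of torus ?\<phi>]) (auto intro: compact_Times)
  \<comment> \<open>\<open>P1\<close> and \<open>P2\<close> factor through the embedded torus, so
    precomposition with the continuous chart transfers the homotopy to the product of the quotient
    spaces.\<close>
  from homotopic_with_compose_continuous_map_right
    [OF this continuous_map_torus_chart[OF k(1) assms(1)], of "\<lambda>_. True"]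
  have "homotopic_with (\<lambda>_. True) (prod_topology (quotient_space K) (quotient_space (multiples T)))
      (top_of_set GL) (G1 \<circ> map_prod (circle_chart k) (circle_chart T))
      (G2 \<circ> map_prod (circle_chart k) (circle_chart T))"
    by (simp add: k(2))
  then show ?thesis
  proof (rule homotopic_with_eq)
    fix c assume "c \<in> topspace (prod_topology (quotient_space K) (quotient_space (multiples T)))"
    then obtain x t where c: "c = (coset K x, coset (multiples T) t)"
      by (auto simp: topspace_quotient_space)
    have "map_prod (circle_chart k) (circle_chart T) c = ?\<phi> (x, t)"
      using circle_chart_coset[OF k(1)] circle_chart_coset[OF assms(1)]
      by (simp add: c k(2) torus_param_def)
    then show "P1 c = (G1 \<circ> map_prod (circle_chart k) (circle_chart T)) c"
      "P2 c = (G2 \<circ> map_prod (circle_chart k) (circle_chart T)) c"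
      using c by (simp_all add: G1(3,4) G2(3,4))
  qed simp
qed

end
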